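(* Consider the system $x_{t+1}=Ax_t+Bu_t+w_t$ with deterministic fixed initial state $x_0$, and suppose that the noise covariance $\Sigma_w$ is known, so that it may be used in the controller. For a measured state $x_t$, let $\mathcal P_S(x_t)$ denote the benchmark SMPC problem $$\min\; \bar x_{t+N|t}^TP\bar x_{t+N|t}+\sum_{k=0}^{N-1}\left(\bar x_{t+k|t}^TQ\bar x_{t+k|t}+\bar u_{t+k|t}^TR\bar u_{t+k|t}\right)$$ over $\bar x_{t|t},\dots,\bar x_{t+N|t}\in\mathbb R^n$ and $\bar u_{t|t},\dots,\bar u_{t+N-1|t}\in\mathbb R^m$, subject to - $\bar x_{t+k+1|t}=A\bar x_{t+k|t}+B\bar u_{t+k|t}$ for $k=0,\dots,N-1$; - $\bar x_{t+k|t}\in\bar{\mathcal X}_S$ for $k=1,\dots,N-1$; - $\bar u_{t+k|t}\in\mathcal U\ominus K\mathcal E$ for $k=0,\dots,N-1$; - $\bar x_{t+N|t}\in\bar{\mathcal X}_{f,S}$; - $x_t\in\bar x_{t|t}\oplus\mathcal E$. At each time $t\ge 0$ the problem $\mathcal P_S(x_t)$ is solved and the input $u_t=K(x_t-\bar x^*_{t|t})+\bar u^*_{t|t}$ is applied, where $\bar x^*_{t|t},\bar u^*_{t|t}$ are the corresponding components of the optimal solution. Suppose $\mathcal P_S(x_0)$ is feasible at time step $t=0$. Then: 1. $\mathcal P_S(x_t)$ is feasible at every time step $t\ge 0$. 2. It ensures satisfaction of the chance state constraints at every time step $t\ge0$: $\mathbb P(g_j^Tx_t\le h_j)\ge 1-\alpha_j$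 for all $j=1,\dots,n_x$ and every $t\ge 0$. 3. For all noise realizations, the closed-loop system asymptotically converges to the set $\mathcal E$, i.e. $\lim_{t\to\infty}\operatorname{dist}(x_t,\mathcal E)=0$.
   Context: Setting. $x_t\in\mathbb R^n$, $u_t\in\mathbb R^m$; $A,B$ are known matrices. The noise $(w_t)_{t\ge 0}$ is i.i.d., with a distribution supported on $\mathcal W=\{w\in\mathbb R^n:\|w\|_\infty\le a_w\}$, $a_w>0$ known, with mean $\mathbb E w_t=0$ and covariance $\Sigma_w=\mathbb E w_tw_t^T$. The set $\mathcal U\subseteq\mathbb R^m$ is a polytope containing the origin. The data $g_j\in\mathbb R^n$, $h_j\in\mathbb R$, $\alpha_j\in(0,1)$, $j=1,\dots,n_x$, define the chance state constraints $\mathbb P(g_j^Tx_t\le h_j)\ge1-\alpha_j$. $Q\in\mathbb R^{n\times n}$ and $R\in\mathbb R^{m\times m}$ are positive definite, and $N\ge1$ is the horizon. The notation $z_{t+k|t}$ means the prediction of $z_{t+k}$ made at time $t$; barred quantities are nominal (noise-free). Gains. $K,\bar K\in\mathbb R^{m\times n}$ are such that $A_{cl}=A+BK$ and $\bar A_{cl}=A+B\bar K$ are stable (all eigenvalues strictly inside the unit disc). $P$ is the unique positive definite solution of $\bar A_{cl}^TP\bar A_{cl}-P=-Q-\bar K^TR\bar K$. Sets. $\oplus$ is the Minkowski sum (with $x\oplus S=\{x\}\oplus S$), and $\ominus$ is the Pontryagin difference $S\ominus T=\{s: s+\tau\in S\ \forall \tau\in T\}$; $K\mathcal E=\{Ke:e\in\mathcal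 E\}$. $\mathcal E$ is the minimum robust invariant set for $e^+=A_{cl}e+w$, $w\in\mathcal W$: the nonempty closed set satisfying $A_{cl}\mathcal E\oplus\mathcal W\subseteq\mathcal E$ that is contained in every nonempty closed set with this property. Put $\gamma_j=\max_{e\in\mathcal E}g_j^TA_{cl}e$ and $f(\alpha)=\sqrt{(1-\alpha)/\alpha}$. $\operatorname{dist}(\cdot,\cdot)$ is any fixed distance function. $\bar{\mathcal X}_S$ is the set of all $\bar x\in\mathbb R^n$ such that, for all $j=1,\dots,n_x$, $$g_j^T\bar x\le h_j-\gamma_j-\min\left\{\|g_j\|_1a_w,\ f(\alpha_j)\sqrt{g_j^T\Sigma_wg_j}\right\}.$$ $\bar{\mathcal X}_{f,S}$ is the maximum (largest) invariant set for $\bar x^+=\bar A_{cl}\bar x$ (i.e. $\bar A_{cl}\bar{\mathcal X}_{f,S}\subseteq\bar{\mathcal X}_{f,S}$) satisfying $\bar{\mathcal X}_{f,S}\subseteq\bar{\mathcal X}_S$ and $\bar K\bar{\mathcal X}_{f,S}\subseteq\mathcal U\ominus K\mathcal E$.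
   Formalization: At t=0 the chance constraint is claimed only for those j with g_j^T x_0 ≤ h_j, as feasibility does not constrain x_0 and the claim fails otherwise; the distance function is any metric inducing the usual topology of R^n (the convergence fails, e.g., for the discrete metric). *)

theory Defs
  imports "HOL-Probability.Probability"
begin

definition pos_def :: "real^'n^'n \<Rightarrow> bool" where
  "pos_def S \<longleftrightarrow> transpose S = S \<and> (\<forall>x. x \<noteq> 0 \<longrightarrow> x \<bullet> (S *v x) > 0)"

text \<open>Eigenvalues of a real matrix are taken over the complex numbers.\<close>

definition complex_eigenvalue :: "real^'n^'n \<Rightarrow> complex \<Rightarrow> bool" where
  "complex_eigenvalue F z \<longleftrightarrow> (\<exists>v. v \<noteq> 0 \<and> map_matrix complex_of_real F *v v = z *s v)"

definition stable_matrix :: "real^'n^'n \<Rightarrow> bool" where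
  "stable_matrix F \<longleftrightarrow> (\<forall>z. complex_eigenvalue F z \<longrightarrow> cmod z < 1)"

text \<open>The Minkowski sum is \<^term>\<open>S + T\<close> (or \<^term>\<open>x +o S\<close> for a single point) from
  \<^theory>\<open>HOL-Library.Set_Algebras\<close>.\<close>

definition pontryagin_diff :: "'a::plus set \<Rightarrow> 'a set \<Rightarrow> 'a set" where
  "pontryagin_diff S T = {s. \<forall>\<tau>\<in>T. s + \<tau> \<in> S}"

definition robust_invariant :: "real^'n^'n \<Rightarrow> (real^'n) set \<Rightarrow> (real^'n) set \<Rightarrow> bool" where
  "robust_invariant F W S \<longleftrightarrow> S \<noteq> {} \<and> closed S \<and> (\<lambda>e. F *v e) ` S + W \<subseteq> S"

definition min_robust_invariant :: "real^'n^'n \<Rightarrow> (real^'n) set \<Rightarrow> (real^'n) set \<Rightarrow> bool" where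
  "min_robust_invariant F W S \<longleftrightarrow>
     robust_invariant F W S \<and> (\<forall>S'. robust_invariant F W S' \<longrightarrow> S \<subseteq> S')"

definition admissible_invariant ::
  "real^'n^'n \<Rightarrow> real^'n^'m \<Rightarrow> (real^'n) set \<Rightarrow> (real^'m) set \<Rightarrow> (real^'n) set \<Rightarrow> bool" where
  "admissible_invariant F K X V S \<longleftrightarrow>
     (\<lambda>x. F *v x) ` S \<subseteq> S \<and> S \<subseteq> X \<and> (\<lambda>x. K *v x) ` S \<subseteq> V"

definition max_admissible_invariant ::
  "real^'n^'n \<Rightarrow> real^'n^'m \<Rightarrow> (real^'n) set \<Rightarrow> (real^'m) set \<Rightarrow> (real^'n) set \<Rightarrow> bool" where
  "max_admissible_invariant F K X V S \<longleftrightarrow>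
     admissible_invariant F K X V S \<and> (\<forall>S'. admissible_invariant F K X V S' \<longrightarrow> S' \<subseteq> S)"

definition tightened_states ::
  "nat \<Rightarrow> (nat \<Rightarrow> real^'n) \<Rightarrow> (nat \<Rightarrow> real) \<Rightarrow> (nat \<Rightarrow> real) \<Rightarrow> (nat \<Rightarrow> real) \<Rightarrow> real \<Rightarrow> real^'n^'n
     \<Rightarrow> (real^'n) set" where
  "tightened_states nx g h \<alpha> \<gamma> aw \<Sigma> = {xb. \<forall>j\<in>{1..nx}.
     g j \<bullet> xb \<le> h j - \<gamma> j
       - min ((\<Sum>i\<in>UNIV. \<bar>g j $ i\<bar>) * aw)
             (sqrt ((1 - \<alpha> j) / \<alpha> j) * sqrt (g j \<bullet> (\<Sigma> *v g j)))}"

text \<open>A decision of the finite-horizon problem is a pair \<^term>\<open>(xs, us)\<close> of nominal state and input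
  sequences; \<^term>\<open>xs k\<close> and \<^term>\<open>us k\<close> are the predictions \<open>k\<close> steps ahead.  Only the entries
  \<^term>\<open>xs k\<close> with \<open>k \<le> N\<close> and \<^term>\<open>us k\<close> with \<open>k < N\<close> matter.\<close>

definition smpc_constraints ::
  "real^'n^'n \<Rightarrow> real^'m^'n \<Rightarrow> nat \<Rightarrow> (real^'n) set \<Rightarrow> (real^'m) set \<Rightarrow> (real^'n) set \<Rightarrow> (real^'n) set
     \<Rightarrow> real^'n \<Rightarrow> (nat \<Rightarrow> real^'n) \<times> (nat \<Rightarrow> real^'m) \<Rightarrow> bool" where
  "smpc_constraints A B N X V Xf E x = (\<lambda>(xs, us).
     (\<forall>k<N. xs (Suc k) = A *v xs k + B *v us k) \<and>
     (\<forall>k\<in>{1..<N}. xs k \<in> X) \<and>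
     (\<forall>k<N. us k \<in> V) \<and>
     xs N \<in> Xf \<and>
     x \<in> xs 0 +o E)"

definition smpc_cost ::
  "real^'n^'n \<Rightarrow> real^'n^'n \<Rightarrow> real^'m^'m \<Rightarrow> nat \<Rightarrow> (nat \<Rightarrow> real^'n) \<times> (nat \<Rightarrow> real^'m) \<Rightarrow> real" where
  "smpc_cost P Q R N = (\<lambda>(xs, us).
     xs N \<bullet> (P *v xs N) + (\<Sum>k<N. xs k \<bullet> (Q *v xs k) + us k \<bullet> (R *v us k)))"

definition smpc_feasible ::
  "real^'n^'n \<Rightarrow> real^'m^'n \<Rightarrow> nat \<Rightarrow> (real^'n) set \<Rightarrow> (real^'m) set \<Rightarrow> (real^'n) set \<Rightarrow> (real^'n) set
     \<Rightarrow> real^'n \<Rightarrow> bool" where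
  "smpc_feasible A B N X V Xf E x \<longleftrightarrow> (\<exists>s. smpc_constraints A B N X V Xf E x s)"

text \<open>The minimizer picked by \<^const>\<open>arg_min\<close> is arbitrary in the irrelevant entries; the input below
  uses only its entries at index 0.  At infeasible states the value is irrelevant.\<close>

definition smpc_input ::
  "real^'n^'n \<Rightarrow> real^'m^'n \<Rightarrow> real^'n^'m \<Rightarrow> real^'n^'n \<Rightarrow> real^'n^'n \<Rightarrow> real^'m^'m \<Rightarrow> nat
     \<Rightarrow> (real^'n) set \<Rightarrow> (real^'m) set \<Rightarrow> (real^'n) set \<Rightarrow> (real^'n) set \<Rightarrow> real^'n \<Rightarrow> real^'m" where
  "smpc_input A B K P Q R N X V Xf E x =
     (let (xs, us) = arg_min (smpc_cost P Q R N) (smpc_constraints A B N X V Xf E x)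
      in K *v (x - xs 0) + us 0)"

primrec closed_loop ::
  "real^'n^'n \<Rightarrow> real^'m^'n \<Rightarrow> (real^'n \<Rightarrow> real^'m) \<Rightarrow> real^'n \<Rightarrow> (nat \<Rightarrow> real^'n) \<Rightarrow> nat \<Rightarrow> real^'n" where
  "closed_loop A B \<kappa> x0 w 0 = x0"
| "closed_loop A B \<kappa> x0 w (Suc t) =
     A *v closed_loop A B \<kappa> x0 w t + B *v \<kappa> (closed_loop A B \<kappa> x0 w t) + w t"

end

theory Submission
  imports Defs "HOL-Computational_Algebra.Fundamental_Theorem_Algebra"
begin

text \<open>
  Write \<open>z\<close> and \<open>u\<close> for the first nominal state and input of the optimal plan at \<open>x\<close>, so
  \<open>x = z + e\<close> with \<open>e \<in> E\<close>.  The next state is \<open>(A z + B u) + (Acl e + w)\<close>, and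
  \<open>Acl e + w\<close> lies in \<open>E\<close> again; hence the plan shifted by one step and extended by the terminal
  controller is feasible, and by the Lyapunov equation its cost is smaller by at least \<open>z \<bullet> Q z\<close>.
  The optimal costs therefore decrease, \<open>z\<close> tends to 0 and the state approaches the compact set \<open>E\<close>.
  For the chance constraints, the next nominal state satisfies the tightened constraint surely,
  so only the last noise sample is random relative to the bound: its quantile is controlled by the
  support and by Cantelli's inequality.

  The event in a chance constraint must be measurable, so the controller has to be a Borel function.
  This rests on uniqueness of the optimal \<open>(z, u)\<close>, which needs convexity of the constraint sets,
  including \<open>E\<close>.
\<close>

section \<open>Stable matrices\<close>

text \<open>Once the forcing term stays below a small threshold, the recursion contracts towards a
  ball of half the target radius, and the transient decays geometrically.\<close>

lemma affine_recursion_tendsto_zero: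
  fixes a :: "nat \<Rightarrow> complex"
  assumes rec: "\<And>k. a (Suc k) = z * a k + e k" and z: "cmod z < 1" and e: "e \<longlonglongrightarrow> 0"
  shows "a \<longlonglongrightarrow> 0"
proof (rule LIMSEQ_I)
  fix r :: real assume r: "r > 0"
  \<comment> \<open>Chosen so that \<open>r / 2\<close> is the fixed point of the map t ->
    \<open>cmod z * t + \<delta>\<close>, which makes \<open>bound\<close> inductive.\<close>
  define \<delta> where "\<delta> = r / 2 * (1 - cmod z)"
  have "\<delta> > 0" using r z by (simp add: \<delta>_def)
  then obtain K where K: "\<And>k. k \<ge> K \<Longrightarrow> cmod (e k) < \<delta>"
    using LIMSEQ_D[OF e] by auto
  have bound: "cmod (a (K + m)) \<le> cmod z ^ m * cmod (a K) + r / 2" for m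
  proof (induction m)
    case 0
    then show ?case using r by simp
  next
    case (Suc m)
    have "cmod (a (K + Suc m)) \<le> cmod z * cmod (a (K + m)) + cmod (e (K + m))"
      using norm_triangle_ineq[of "z * a (K + m)" "e (K + m)"] by (simp add: rec norm_mult)
    also have "\<dots> \<le> cmod z * (cmod z ^ m * cmod (a K) + r / 2) + \<delta>"
      using Suc K[of "K + m"] by (intro add_mono mult_left_mono) auto
    also have "\<dots> = cmod z ^ Suc m * cmod (a K) + r / 2"
      by (simp add: \<delta>_def field_simps)
    finally show ?case .
  qed
  have "(\<lambda>m. cmod z ^ m * cmod (a K)) \<longlonglongrightarrow> 0"
    using LIMSEQ_power_zero[of "cmod z"] z by (intro tendsto_mult_left_zero) auto
  then obtain M where M: "\<And>m. m \<ge> M \<Longrightarrow> \<bar>cmod z ^ m * cmod (a K)\<bar> < r / 2"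
    using LIMSEQ_D[of _ 0 "r/2"] r by fastforce
  show "\<exists>no. \<forall>n\<ge>no. norm (a n - 0) < r"
  proof (intro exI allI impI)
    fix n assume "n \<ge> K + M"
    then obtain m where "n = K + m" "m \<ge> M" by (metis add_le_cancel_left le_Suc_ex le_add1 order_trans)
    then show "norm (a n - 0) < r" using bound[of m] M[of m] by simp
  qed
qed

lemma funpow_linear:
  fixes f :: "'a::real_vector \<Rightarrow> 'a"
  shows "linear f \<Longrightarrow> linear (f ^^ k)"
proof (induction k)
  case 0
  then show ?case by (simp add: linear_iff)
next
  case (Suc k)
  then show ?case using linear_compose[of "f ^^ k" f] by (simp add: comp_def)
qed

lemma matrix_vector_mult_sum_scale:
  fixes G :: "'a::field^'n^'n"
  shows "G *v (\<Sum>i\<in>I. c i *s x i) = (\<Sum>i\<in>I. c i *s (G *v x i))"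
  by (induction I rule: infinite_finite_induct) (auto simp: matrix_vector_right_distrib vec.scale)

lemma funpow_matrix_diff_scale:
  fixes G :: "'a::field^'n^'n"
  shows "((*v) G ^^ k) (u - z *s v) = ((*v) G ^^ k) u - z *s ((*v) G ^^ k) v"
  by (induction k) (auto simp: matrix_vector_mult_diff_distrib vec.scale)

text \<open>Induction on a degree bound for a polynomial annihilating \<open>v\<close>, peeling off
  one root: p = (X - z) q. Either \<open>q\<close> already annihilates \<open>v\<close>, or q(G) v
  is an eigenvector for \<open>z\<close>, so \<open>cmod z < 1\<close>; then the orbit of
  \<open>v\<close> obeys a recursion with factor \<open>z\<close>, forced by the orbit of (G - z) v,
  which \<open>q\<close> annihilates.\<close>

lemma annihilated_orbit_tendsto_zero:
  fixes G :: "complex^'n^'n"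
  assumes G: "\<And>z u. u \<noteq> 0 \<Longrightarrow> G *v u = z *s u \<Longrightarrow> cmod z < 1"
  shows "degree p \<le> n \<Longrightarrow> p \<noteq> 0 \<Longrightarrow> (\<Sum>i\<le>n. coeff p i *s ((*v) G ^^ i) v) = 0
    \<Longrightarrow> (\<lambda>k. ((*v) G ^^ k) v $ j) \<longlonglongrightarrow> 0"
proof (induction n arbitrary: p v j)
  case 0
  then have "v = 0" using leading_coeff_0_iff[of p] by simp
  moreover have "((*v) G ^^ k) 0 = 0" for k by (induction k) auto
  ultimately show ?case by simp
next
  case (Suc n)
  show ?case
  proof (cases "degree p = 0")
    case True
    have "(\<Sum>i\<le>Suc n. coeff p i *s ((*v) G ^^ i) v) = coeff p 0 *s v"
      using True by (simp add: sum.atMost_Suc_shift coeff_eq_0 del: sum.atMost_Suc)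
    then have "v = 0" using Suc.prems True leading_coeff_0_iff[of p] by simp
    moreover have "((*v) G ^^ k) 0 = 0" for k by (induction k) auto
    ultimately show ?thesis by simp
  next
    case False
    then obtain z where "poly p z = 0" using alg_closed_imp_poly_has_root[of p] by auto
    then obtain q where q: "p = [:- z, 1:] * q" using poly_eq_0_iff_dvd by blast
    have "q \<noteq> 0" using q Suc.prems by auto
    then have "degree p = 1 + degree q" unfolding q by (subst degree_mult_eq) auto
    then have "degree q \<le> n" using Suc.prems by simp
    define S where "S = (\<lambda>v. \<Sum>i\<le>n. coeff q i *s ((*v) G ^^ i) v)"
    \<comment> \<open>\<open>pCons 0 q\<close> is X times \<open>q\<close>, so the sum for
      \<open>p\<close> becomes G - z applied to \<open>S v\<close>, where \<open>S v\<close> is q(G)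
      v.\<close>
    have cp: "coeff p i = - z * coeff q i + coeff (pCons 0 q) i" for i
      unfolding q by simp
    have "(\<Sum>i\<le>Suc n. coeff p i *s ((*v) G ^^ i) v)
      = - z *s (\<Sum>i\<le>Suc n. coeff q i *s ((*v) G ^^ i) v)
        + (\<Sum>i\<le>Suc n. coeff (pCons 0 q) i *s ((*v) G ^^ i) v)"
      unfolding cp vec.scale_left_distrib sum.distrib vec.scale_sum_right vec.scale_scale ..
    also have "(\<Sum>i\<le>Suc n. coeff q i *s ((*v) G ^^ i) v) = S v"
      using \<open>degree q \<le> n\<close> by (simp add: S_def coeff_eq_0)
    also have "(\<Sum>i\<le>Suc n. coeff (pCons 0 q) i *s ((*v) G ^^ i) v) = G *v S v"
      by (subst sum.atMost_Suc_shift) (simp add: S_def matrix_vector_mult_sum_scale)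
    finally have GS: "G *v S v = z *s S v" using Suc.prems by simp
    show ?thesis
    proof (cases "S v = 0")
      case True
      then show ?thesis using Suc.IH[OF \<open>degree q \<le> n\<close> \<open>q \<noteq> 0\<close>] by (simp add: S_def)
    next
      case False
      then have z: "cmod z < 1" using G GS by blast
      define u where "u = G *v v - z *s v"
      have comm: "((*v) G ^^ i) (G *v v) = G *v ((*v) G ^^ i) v" for i
        by (simp add: funpow_swap1)
      have "S u = G *v S v - z *s S v"
        unfolding S_def u_def funpow_matrix_diff_scale matrix_vector_mult_sum_scale comm
        by (simp add: vec.scale_sum_right sum_subtractf vec.scale_right_diff_distrib
           mult.commute)
      then have "S u = 0" using GS by simp
      then have lim: "(\<lambda>k. ((*v) G ^^ k) u $ j) \<longlonglongrightarrow> 0"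
        using Suc.IH[OF \<open>degree q \<le> n\<close> \<open>q \<noteq> 0\<close>] by (simp add: S_def)
      have "((*v) G ^^ Suc k) v $ j = z * ((*v) G ^^ k) v $ j + ((*v) G ^^ k) u $ j" for k
        unfolding u_def funpow_matrix_diff_scale comm by simp
      then show ?thesis using z lim by (rule affine_recursion_tendsto_zero)
    qed
  qed
qed

text \<open>Supplies an annihilating polynomial for a single vector. The family is indexed, so a
  repeated vector is treated apart: coefficients 1 and -1 at its two indices give a
  relation.\<close>

lemma orbit_dependent:
  fixes x :: "nat \<Rightarrow> 'a::euclidean_space"
  obtains n c where "\<exists>i\<le>n. c i \<noteq> 0" "(\<Sum>i\<le>n. c i *\<^sub>R x i) = 0"
proof (cases "inj_on x {..DIM('a)}")
  case True
  then have "dependent (x ` {..DIM('a)})"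
    by (intro dependent_biggerset) (auto simp: card_image)
  then obtain u where u: "\<exists>v\<in>x ` {..DIM('a)}. u v \<noteq> 0" "(\<Sum>v\<in>x ` {..DIM('a)}. u v *\<^sub>R v) = 0"
    by (auto simp: dependent_finite)
  show ?thesis
    by (rule that[of "DIM('a)" "\<lambda>i. u (x i)"]) (use u True in \<open>auto simp: sum.reindex\<close>)
next
  case False
  then obtain i j where ij: "i \<le> DIM('a)" "j \<le> DIM('a)" "i \<noteq> j" "x i = x j"
    by (auto simp: inj_on_def)
  define c where "c = (\<lambda>k. if k = i then 1 else if k = j then -1 else (0::real))"
  have "(\<Sum>k\<le>DIM('a). c k *\<^sub>R x k) = (\<Sum>k\<in>{i, j}. c k *\<^sub>R x k)"
    using ij by (intro sum.mono_neutral_right) (auto simp: c_def)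
  also have "\<dots> = 0" using ij by (simp add: c_def)
  finally have "(\<Sum>k\<le>DIM('a). c k *\<^sub>R x k) = 0" .
  moreover have "c i \<noteq> 0" by (simp add: c_def)
  ultimately show ?thesis using that ij(1) by blast
qed

text \<open>The orbit is embedded in complex space, where the annihilating polynomial obtained from
  a real linear dependence has roots.\<close>

lemma stable_matrix_orbit_tendsto_zero:
  fixes F :: "real^'n^'n"
  assumes "stable_matrix F"
  shows "(\<lambda>k. ((*v) F ^^ k) v) \<longlonglongrightarrow> 0"
proof -
  define G where "G = (map_matrix complex_of_real F)"
  define cv where "cv = (\<lambda>v::real^'n. \<chi> i. complex_of_real (v $ i))"
  have "G *v cv v = cv (F *v v)" for v
    by (simp add: G_def cv_def vec_eq_iff matrix_vector_mult_def map_matrix_def)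
  then have pow: "((*v) G ^^ k) (cv v) = cv (((*v) F ^^ k) v)" for k v
    by (induction k) auto
  obtain n c where c: "\<exists>i\<le>n. c i \<noteq> 0" "(\<Sum>i\<le>n. c i *\<^sub>R ((*v) F ^^ i) v) = 0"
    by (rule orbit_dependent)
  define p where "p = (\<Sum>i\<le>n. monom (complex_of_real (c i)) i)"
  have coeff: "coeff p i = (if i \<le> n then complex_of_real (c i) else 0)" for i
    by (simp add: p_def coeff_sum if_distrib sum.delta cong: if_cong)
  have "degree p \<le> n" by (rule degree_le) (simp add: coeff)
  moreover have "p \<noteq> 0" using c(1) coeff by (metis coeff_0 of_real_eq_0_iff)
  moreover have "(\<Sum>i\<le>n. coeff p i *s ((*v) G ^^ i) (cv v)) = cv (\<Sum>i\<le>n. c i *\<^sub>R ((*v) F ^^ i) v)"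
    unfolding pow by (simp add: cv_def vec_eq_iff coeff)
  then have "(\<Sum>i\<le>n. coeff p i *s ((*v) G ^^ i) (cv v)) = 0"
    by (simp add: c cv_def vec_eq_iff)
  ultimately have "(\<lambda>k. ((*v) G ^^ k) (cv v) $ j) \<longlonglongrightarrow> 0" for j
    using assms by (intro annihilated_orbit_tendsto_zero[of G p n])
      (auto simp: stable_matrix_def complex_eigenvalue_def G_def)
  then have "(\<lambda>k. complex_of_real (((*v) F ^^ k) v $ j)) \<longlonglongrightarrow> complex_of_real 0" for j
    unfolding pow by (simp add: cv_def)
  then have "(\<lambda>k. ((*v) F ^^ k) v $ j) \<longlonglongrightarrow> 0" for j
    by (simp only: tendsto_of_real_iff)
  then show ?thesis by (intro vec_tendstoI) auto
qed

text \<open>The adapted norm is the sum of \<open>(1/r) ^ i * norm (T i x)\<close> over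
  \<open>i < k\<close>, where \<open>T k\<close> at least halves the norm and
  \<open>r ^ k = 1/2\<close>. Applying \<open>F\<close> shifts the index, which costs a factor
  \<open>r\<close>; the new term at \<open>k\<close> is at most \<open>norm x\<close>, the term that
  drops out at 0.\<close>

lemma stable_matrix_contraction_norm:
  fixes F :: "real^'n^'n"
  assumes "stable_matrix F"
  obtains \<nu> r where "continuous_on UNIV \<nu>" "\<And>x y. \<nu> (x + y) \<le> \<nu> x + \<nu> y" "\<And>x. norm x \<le> \<nu> x"
    "\<And>x. \<nu> (F *v x) \<le> r * \<nu> x" "0 < r" "r < (1::real)"
proof -
  define T where "T = (\<lambda>k. (*v) F ^^ k)"
  have lin: "linear (T k)" for k unfolding T_def by (rule funpow_linear) (rule matrix_vector_mul_linear)
  have "(\<lambda>k. \<Sum>b\<in>Basis. norm (T k b)) \<longlonglongrightarrow> (\<Sum>b\<in>(Basis::(real^'n) set). 0)"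
    using stable_matrix_orbit_tendsto_zero[OF assms]
    by (intro tendsto_sum tendsto_norm_zero) (simp add: T_def)
  then have "eventually (\<lambda>k. (\<Sum>b\<in>Basis. norm (T k b)) < 1/2) sequentially"
    by (intro order_tendstoD) auto
  then obtain k0 where k0: "\<And>k. k \<ge> k0 \<Longrightarrow> (\<Sum>b\<in>Basis. norm (T k b)) < 1/2"
    by (auto simp: eventually_sequentially)
  \<comment> \<open>The successor makes \<open>k\<close> positive: the root of order
    \<open>k\<close> is then meaningful and the sum defining \<open>\<nu>\<close> contains
    \<open>norm x\<close>.\<close>
  define k where "k = Suc k0"
  have half: "norm (T k x) \<le> 1/2 * norm x" for x
  proof -
    have "T k x = (\<Sum>b\<in>Basis. (x \<bullet> b) *\<^sub>R T k b)"
      using linear_sum[OF lin] linear_scale[OF lin] euclidean_representation[of x]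
      by (metis (mono_tags, lifting) sum.cong)
    also have "norm \<dots> \<le> (\<Sum>b\<in>Basis. norm x * norm (T k b))"
      by (intro sum_norm_le) (auto simp: Basis_le_norm intro!: mult_right_mono)
    also have "\<dots> = norm x * (\<Sum>b\<in>Basis. norm (T k b))" by (simp add: sum_distrib_left)
    also have "\<dots> \<le> norm x * (1/2)" using k0[of k] by (intro mult_left_mono) (auto simp: k_def)
    finally show ?thesis by simp
  qed
  define r where "r = root k (1/2)"
  have rk: "r ^ k = 1/2" unfolding r_def by (rule real_root_pow_pos2) (auto simp: k_def)
  have r: "0 < r" "r < 1"
    unfolding r_def using real_root_lt_1_iff[of k "1/2"] by (auto simp: k_def)
  define \<nu> where "\<nu> = (\<lambda>x. \<Sum>i<k. (1/r) ^ i * norm (T i x))"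
  show ?thesis
  proof (rule that[of \<nu> r])
    show "continuous_on UNIV \<nu>" unfolding \<nu>_def
      by (intro continuous_intros linear_continuous_on linear_conv_bounded_linear[THEN iffD1] lin)
    show "\<nu> (x + y) \<le> \<nu> x + \<nu> y" for x y
      unfolding \<nu>_def sum.distrib[symmetric] linear_add[OF lin]
      using r by (intro sum_mono) (simp only: distrib_left[symmetric], intro mult_left_mono norm_triangle_ineq, simp)
    show "norm x \<le> \<nu> x" for x
      unfolding \<nu>_def k_def sum.lessThan_Suc_shift using r by (auto simp: T_def intro!: sum_nonneg)
    show "\<nu> (F *v x) \<le> r * \<nu> x" for x
    proof -
      have sh: "T i (F *v x) = T (Suc i) x" for i by (simp add: T_def funpow_swap1)
      have "\<nu> (F *v x) = r * (\<Sum>i<k. (1/r) ^ Suc i * norm (T (Suc i) x))"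
        using r by (simp add: \<nu>_def sh sum_distrib_left field_simps)
      also have "(\<Sum>i<k. (1/r) ^ Suc i * norm (T (Suc i) x)) = (\<Sum>i<Suc k. (1/r) ^ i * norm (T i x)) - norm x"
        by (subst sum.lessThan_Suc_shift) (simp add: T_def)
      also have "\<dots> = \<nu> x + (1/r)^k * norm (T k x) - norm x" by (simp add: \<nu>_def)
      also have "(1/r)^k * norm (T k x) = 2 * norm (T k x)" by (simp add: power_one_over rk)
      finally show ?thesis using r half[of x] by simp
    qed
  qed (use r in auto)
qed

section \<open>Invariant sets\<close>

text \<open>A sublevel set of the adapted norm works as soon as its radius absorbs one contraction
  followed by one disturbance.\<close>

lemma robust_invariant_bounded_exists:
  fixes F :: "real^'n^'n"
  assumes F: "stable_matrix F" and W: "bounded W" "W \<noteq> {}"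
  obtains S where "robust_invariant F W S" "bounded S"
proof -
  obtain \<nu> r where \<nu>: "continuous_on UNIV \<nu>" "\<And>x y. \<nu> (x + y) \<le> \<nu> x + \<nu> y" "\<And>x. norm x \<le> \<nu> x"
    "\<And>x. \<nu> (F *v x) \<le> r * \<nu> x" "0 < r" "r < (1::real)"
    by (rule stable_matrix_contraction_norm[OF F]) blast
  have "compact (\<nu> ` closure W)"
    using W \<nu>(1) by (intro compact_continuous_image) (auto intro: continuous_on_subset)
  then have "bdd_above (\<nu> ` W)"
    by (meson bounded_imp_bdd_above bounded_subset closure_subset compact_imp_bounded image_mono)
  then obtain c where c: "\<And>w. w \<in> W \<Longrightarrow> \<nu> w \<le> c"
    by (auto simp: bdd_above_def)
  \<comment> \<open>The fixed point of \<open>r * \<rho> + c\<close>, with \<open>c\<close> a bound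
    for \<open>\<nu>\<close> on \<open>W\<close>.\<close>
  define \<rho> where "\<rho> = c / (1 - r)"
  obtain w0 where "w0 \<in> W" using W by blast
  then have "0 \<le> c" using c[of w0] \<nu>(3)[of w0] norm_ge_zero[of w0] by linarith
  then have \<rho>: "r * \<rho> + c = \<rho>" "c \<le> \<rho>" using \<nu>(5,6) by (auto simp: \<rho>_def field_simps)
  define S where "S = {x. \<nu> x \<le> \<rho>}"
  have "F *v e + w \<in> S" if "e \<in> S" "w \<in> W" for e w
  proof -
    have "\<nu> (F *v e + w) \<le> r * \<nu> e + c"
      using \<nu>(2)[of "F *v e" w] \<nu>(4)[of e] c[OF that(2)] by linarith
    also have "\<dots> \<le> r * \<rho> + c" using that \<nu>(5) by (simp add: S_def)
    finally show ?thesis using \<rho> by (simp add: S_def)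
  qed
  moreover have "closed S" unfolding S_def by (intro closed_Collect_le \<nu>) auto
  moreover have "w0 \<in> S" using c[OF \<open>w0 \<in> W\<close>] \<rho> by (simp add: S_def)
  moreover have "bounded S" by (rule boundedI[of _ \<rho>]) (metis S_def \<nu>(3) mem_Collect_eq order_trans)
  ultimately show ?thesis by (intro that[of S]) (auto simp: robust_invariant_def elim!: set_plus_elim)
qed

text \<open>Minimality places \<open>E\<close> inside the bounded invariant set just
  constructed.\<close>

lemma min_robust_invariant_compact:
  fixes F :: "real^'n^'n"
  assumes "stable_matrix F" "bounded W" "W \<noteq> {}" and E: "min_robust_invariant F W E"
  shows "compact E"
proof -
  obtain S where "robust_invariant F W S" "bounded S"
    using assms(1-3) by (rule robust_invariant_bounded_exists)
  then show ?thesis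
    using E bounded_subset[of S E]
    by (simp add: min_robust_invariant_def robust_invariant_def compact_eq_bounded_closed)
qed

text \<open>Every point of \<open>C\<close> has backward orbits of any length inside
  \<open>C\<close>. Replaying their disturbances from a point of \<open>E\<close> stays in
  \<open>E\<close>, and by stability the two end points approach each other; closedness of
  \<open>E\<close> finishes.\<close>

lemma robust_invariant_superset:
  fixes F :: "real^'n^'n"
  assumes F: "stable_matrix F" and C: "bounded C" "C \<subseteq> (*v) F ` C + W"
    and E: "robust_invariant F W E"
  shows "C \<subseteq> E"
proof
  fix c assume "c \<in> C"
  define T where "T = (\<lambda>k. (*v) F ^^ k)"
  have lin: "linear (T k)" for k
    unfolding T_def by (rule funpow_linear) (rule matrix_vector_mul_linear)
  obtain e where e: "e \<in> E" using E by (auto simp: robust_invariant_def)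
  have inv: "F *v x + w \<in> E" if "x \<in> E" "w \<in> W" for x w
    using E that by (auto simp: robust_invariant_def intro: set_plus_intro)
  \<comment> \<open>Here \<open>c'\<close> is the state \<open>k\<close> steps back; by linearity
    the replayed end point differs from \<open>c\<close> only through the starting points
    \<open>c'\<close> and \<open>e\<close>.\<close>
  have "\<forall>c\<in>C. \<exists>c'\<in>C. c - T k c' + T k e \<in> E" for k
  proof (induction k)
    case 0
    then show ?case using e by (force simp: T_def)
  next
    case (Suc k)
    show ?case
    proof
      fix c assume "c \<in> C"
      then obtain c1 w where c1: "c1 \<in> C" "w \<in> W" "c = F *v c1 + w"
        using C(2) by (auto elim!: set_plus_elim)
      then obtain c' where c': "c' \<in> C" "c1 - T k c' + T k e \<in> E" using Suc by blast
      have "F *v (c1 - T k c' + T k e) + w = c - T (Suc k) c' + T (Suc k) e"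
        by (simp add: c1 T_def matrix_vector_right_distrib matrix_vector_mult_diff_distrib)
      then show "\<exists>c'\<in>C. c - T (Suc k) c' + T (Suc k) e \<in> E"
        using inv[OF c'(2) c1(2)] c'(1) by auto
    qed
  qed
  then have "\<exists>c'. c' \<in> C \<and> c - T k c' + T k e \<in> E" for k
    using \<open>c \<in> C\<close> by blast
  then obtain s where s: "\<And>k. s k \<in> C" "\<And>k. c - T k (s k) + T k e \<in> E"
    by metis
  obtain b where b: "\<And>x. x \<in> C \<Longrightarrow> norm x \<le> b" using C(1) by (auto simp: bounded_iff)
  \<comment> \<open>The argument \<open>s k\<close> varies with \<open>k\<close>, so pointwise decay
    does not suffice; expanding in the basis makes it uniform on the bounded set
    \<open>C\<close>.\<close>
  have "(\<lambda>k. T k (s k)) \<longlonglongrightarrow> 0"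
  proof (rule Lim_null_comparison)
    show "\<forall>\<^sub>F k in sequentially. norm (T k (s k)) \<le> (\<Sum>i\<in>Basis. b * norm (T k i))"
    proof (rule always_eventually, rule allI)
      fix k
      have "T k (s k) = T k (\<Sum>i\<in>Basis. (s k \<bullet> i) *\<^sub>R i)" by (simp add: euclidean_representation)
      also have "\<dots> = (\<Sum>i\<in>Basis. (s k \<bullet> i) *\<^sub>R T k i)"
        by (simp add: linear_sum[OF lin] linear_scale[OF lin])
      also have "norm \<dots> \<le> (\<Sum>i\<in>Basis. b * norm (T k i))"
        using b[OF s(1)[of k]] by (intro sum_norm_le)
          (auto intro!: mult_right_mono intro: order_trans[OF Basis_le_norm])
      finally show "norm (T k (s k)) \<le> (\<Sum>i\<in>Basis. b * norm (T k i))" .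
    qed
    have "(\<lambda>k. \<Sum>i\<in>Basis. b * norm (T k i)) \<longlonglongrightarrow> (\<Sum>i\<in>(Basis::(real^'n) set). b * norm (0::real^'n))"
      using stable_matrix_orbit_tendsto_zero[OF F] unfolding T_def by (intro tendsto_intros)
    then show "(\<lambda>k. \<Sum>i\<in>Basis. b * norm (T k i)) \<longlonglongrightarrow> 0" by simp
  qed
  then have "(\<lambda>k. c - T k (s k) + T k e) \<longlonglongrightarrow> c - 0 + 0"
    using stable_matrix_orbit_tendsto_zero[OF F] unfolding T_def by (intro tendsto_intros)
  moreover have "closed E" using E by (simp add: robust_invariant_def)
  ultimately show "c \<in> E" using closed_sequentially[OF _ s(2)] by simp
qed

lemma compact_plus:
  fixes S T :: "'a::real_normed_vector set"
  assumes "compact S" "compact T"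
  shows "compact (S + T)"
  using compact_sums[OF assms] by (simp add: set_plus_def Bex_def conj_ac)

text \<open>Minimality forces \<open>E = F E + W\<close>, so \<open>convex hull E \<subseteq> F (convex hull E) + W\<close>, and the contraction
  argument above puts the hull inside \<open>E\<close>.\<close>
lemma min_robust_invariant_convex:
  fixes F :: "real^'n^'n"
  assumes F: "stable_matrix F" and W: "compact W" "convex W" "W \<noteq> {}"
    and E: "min_robust_invariant F W E"
  shows "convex E"
proof -
  have cE: "compact E"
    using F W E by (auto intro: min_robust_invariant_compact compact_imp_bounded)
  have inv: "robust_invariant F W E" using E by (simp add: min_robust_invariant_def)
  define E' where "E' = (*v) F ` E + W"
  have "E' \<subseteq> E" using inv by (simp add: E'_def robust_invariant_def)
  \<comment> \<open>Compactness is what makes the Minkowski sum \<open>E'\<close> closed, hence a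
    competitor in the definition of the minimal set.\<close>
  have "compact ((*v) F ` E)"
    using cE by (intro compact_continuous_image continuous_intros) auto
  then have "compact E'" using W by (simp add: E'_def compact_plus)
  moreover have "E' \<noteq> {}" using inv W by (auto simp: E'_def robust_invariant_def set_plus_def)
  moreover have "(*v) F ` E' + W \<subseteq> E'"
    unfolding E'_def[of] using \<open>E' \<subseteq> E\<close>
    by (metis E'_def image_mono set_plus_mono2 subset_refl)
  ultimately have "robust_invariant F W E'" by (simp add: robust_invariant_def compact_imp_closed)
  then have "E \<subseteq> E'" using E by (simp add: min_robust_invariant_def)
  define C where "C = convex hull E"
  have "E' \<subseteq> (*v) F ` C + W"
    unfolding E'_def C_def by (intro set_plus_mono2 image_mono hull_subset subset_refl)
  moreover have "convex ((*v) F ` C + W)"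
    unfolding C_def using W by (intro convex_set_plus convex_linear_image) auto
  ultimately have "C \<subseteq> (*v) F ` C + W"
    using \<open>E \<subseteq> E'\<close> by (subst C_def) (intro hull_minimal, auto)
  moreover have "bounded C" using cE by (simp add: C_def bounded_convex_hull compact_imp_bounded)
  ultimately have "C \<subseteq> E" using robust_invariant_superset[OF F] inv by blast
  then have "convex hull E = E" using hull_subset[of E convex] by (auto simp: C_def)
  then show ?thesis by (metis convex_convex_hull)
qed

text \<open>By continuity the closure satisfies the same three inclusions, so maximality absorbs
  it.\<close>

lemma max_admissible_invariant_closed:
  fixes F :: "real^'n^'n" and K :: "real^'n^'m"
  assumes S: "max_admissible_invariant F K X V S" and X: "closed X" and V: "closed V"
  shows "closed S"
proof -
  have adm: "(*v) F ` S \<subseteq> S" "S \<subseteq> X" "(*v) K ` S \<subseteq> V"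
    using S by (auto simp: max_admissible_invariant_def admissible_invariant_def)
  have "(*v) F ` closure S \<subseteq> closure S"
    using closure_linear_image_subset[of "(*v) F" S] closure_mono[OF adm(1)] by auto
  moreover have "closure S \<subseteq> X" using adm(2) X by (simp add: closure_minimal)
  moreover have "(*v) K ` closure S \<subseteq> V"
    using closure_linear_image_subset[of "(*v) K" S] closure_minimal[OF adm(3) V] by auto
  ultimately have "closure S \<subseteq> S"
    using S by (auto simp: max_admissible_invariant_def admissible_invariant_def)
  then show ?thesis using closure_subset_eq by blast
qed

text \<open>As for the closure, now with the convex hull, which commutes with linear maps.\<close>

lemma max_admissible_invariant_convex:
  fixes F :: "real^'n^'n" and K :: "real^'n^'m"
  assumes S: "max_admissible_invariant F K X V S" and X: "convex X" and V: "convex V"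
  shows "convex S"
proof -
  have adm: "(*v) F ` S \<subseteq> S" "S \<subseteq> X" "(*v) K ` S \<subseteq> V"
    using S by (auto simp: max_admissible_invariant_def admissible_invariant_def)
  have "(*v) F ` (convex hull S) \<subseteq> convex hull S"
    unfolding convex_hull_linear_image[OF matrix_vector_mul_linear] by (rule hull_mono[OF adm(1)])
  moreover have "convex hull S \<subseteq> X" using adm(2) X by (rule hull_minimal)
  moreover have "(*v) K ` (convex hull S) \<subseteq> V"
    unfolding convex_hull_linear_image[OF matrix_vector_mul_linear] using adm(3) V by (rule hull_minimal)
  ultimately have "convex hull S \<subseteq> S"
    using S by (auto simp: max_admissible_invariant_def admissible_invariant_def)
  then have "convex hull S = S" using hull_subset[of S convex] by auto
  then show ?thesis by (metis convex_convex_hull)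
qed

section \<open>Pontryagin differences and tightened constraint sets\<close>

lemma compact_pontryagin_diff:
  fixes S :: "'a::real_normed_vector set"
  assumes "compact S" "T \<noteq> {}"
  shows "compact (pontryagin_diff S T)"
proof -
  obtain \<tau> where \<tau>: "\<tau> \<in> T" using assms by blast
  \<comment> \<open>An intersection of translates of \<open>S\<close> is closed; a single translate,
    available since \<open>T \<noteq> {}\<close>, already bounds it.\<close>
  have "pontryagin_diff S T = (\<Inter>\<tau>\<in>T. (\<lambda>s. s + \<tau>) -` S)"
    by (auto simp: pontryagin_diff_def)
  then have "closed (pontryagin_diff S T)"
    using assms(1) by (simp only:) (intro closed_INT ballI closed_vimage compact_imp_closed continuous_intros)
  moreover have "pontryagin_diff S T \<subseteq> (\<lambda>s. s - \<tau>) ` S"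
  proof
    fix s assume "s \<in> pontryagin_diff S T"
    then have "s + \<tau> \<in> S" using \<tau> by (simp add: pontryagin_diff_def)
    then show "s \<in> (\<lambda>s. s - \<tau>) ` S" by (intro image_eqI[of _ _ "s + \<tau>"]) auto
  qed
  moreover have "compact ((\<lambda>s. s - \<tau>) ` S)"
    using assms by (intro compact_continuous_image continuous_intros)
  ultimately show ?thesis by (metis closed_Int_compact inf.absorb1)
qed

lemma convex_pontryagin_diff:
  fixes S :: "'a::real_vector set"
  assumes "convex S"
  shows "convex (pontryagin_diff S T)"
proof (rule convexI)
  fix x y and u v :: real
  assume xy: "x \<in> pontryagin_diff S T" "y \<in> pontryagin_diff S T" and uv: "0 \<le> u" "0 \<le> v" "u + v = 1"
  show "u *\<^sub>R x + v *\<^sub>R y \<in> pontryagin_diff S T"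
    unfolding pontryagin_diff_def
  proof (intro CollectI ballI)
    fix \<tau> assume "\<tau> \<in> T"
    then have "x + \<tau> \<in> S" "y + \<tau> \<in> S" using xy by (auto simp: pontryagin_diff_def)
    then have "u *\<^sub>R (x + \<tau>) + v *\<^sub>R (y + \<tau>) \<in> S" using assms uv by (auto intro: convexD)
    also have "u *\<^sub>R (x + \<tau>) + v *\<^sub>R (y + \<tau>) = u *\<^sub>R x + v *\<^sub>R y + (u + v) *\<^sub>R \<tau>"
      by (simp add: algebra_simps)
    finally show "u *\<^sub>R x + v *\<^sub>R y + \<tau> \<in> S" using uv by simp
  qed
qed

lemma tightened_states_closed_convex:
  "closed (tightened_states nx g h \<alpha> \<gamma> aw \<Sigma>)" "convex (tightened_states nx g h \<alpha> \<gamma> aw \<Sigma>)"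
proof -
  have "tightened_states nx g h \<alpha> \<gamma> aw \<Sigma> = (\<Inter>j\<in>{1..nx}. {x. g j \<bullet> x \<le> h j - \<gamma> j
       - min ((\<Sum>i\<in>UNIV. \<bar>g j $ i\<bar>) * aw)
             (sqrt ((1 - \<alpha> j) / \<alpha> j) * sqrt (g j \<bullet> (\<Sigma> *v g j)))})"
    by (auto simp: tightened_states_def)
  then show "closed (tightened_states nx g h \<alpha> \<gamma> aw \<Sigma>)" "convex (tightened_states nx g h \<alpha> \<gamma> aw \<Sigma>)"
    by (auto intro!: closed_INT convex_INT closed_halfspace_le convex_halfspace_le)
qed

section \<open>Minimizers as Borel functions\<close>

text \<open>Tychonoff's theorem for the function type, whose topology is the product
  topology.\<close>

lemma compact_coordinatewise:
  fixes S :: "'i \<Rightarrow> 'b::topological_space set"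
  assumes "\<And>i. compact (S i)"
  shows "compact {f. \<forall>i. f i \<in> S i}"
proof -
  have "{f. \<forall>i. f i \<in> S i} = PiE UNIV S" by auto
  moreover have "compactin (product_topology (\<lambda>_. euclidean) UNIV) (PiE UNIV S)"
    using assms by (simp add: compactin_PiE)
  ultimately show ?thesis by (simp add: euclidean_product_topology)
qed

text \<open>A unique minimizer takes values in \<open>F\<close> iff the value of the problem restricted to \<open>F\<close> does not
  exceed the unrestricted value.  Sublevel sets of both value functions are projections of
  \<open>\<sigma>\<close>-compact sets, hence Borel, and it suffices to compare the values against rational levels.\<close>
lemma borel_unique_minimizer:
  fixes G :: "('a::euclidean_space \<times> 's::t2_space) set" and J :: "'a \<times> 's \<Rightarrow> real"
    and \<pi> :: "'a \<times> 's \<Rightarrow> 'b::topological_space"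
  assumes cpt: "\<And>r. compact (G \<inter> fst -` cball 0 r)"
    and J: "continuous_on UNIV J" and \<pi>: "continuous_on UNIV \<pi>"
    and \<psi>: "\<And>p. p \<in> G \<Longrightarrow> (\<And>q. q \<in> G \<Longrightarrow> fst q = fst p \<Longrightarrow> J p \<le> J q) \<Longrightarrow> \<pi> p = \<psi> (fst p)"
    and F: "closed F"
  shows "{x \<in> fst ` G. \<psi> x \<in> F} \<in> sets borel"
proof -
  have Jc: "closed {p. J p \<le> q}" for q by (intro closed_Collect_le J) auto
  have \<pi>F: "closed {p. \<pi> p \<in> F}" using closed_vimage[OF F \<pi>] by (simp add: vimage_def)
  \<comment> \<open>\<open>L C q\<close> collects the parameters at which the problem restricted to
    \<open>C\<close> attains a value of at most \<open>q\<close>.\<close>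
  define L where "L = (\<lambda>C q. fst ` (G \<inter> C \<inter> {p. J p \<le> q}))"
  have LI: "x \<in> L C q" if "p \<in> G" "p \<in> C" "J p \<le> q" "fst p = x" for p x C q
    using that by (auto simp: L_def)
  have LE: "\<exists>p\<in>G \<inter> C. fst p = x \<and> J p \<le> q" if "x \<in> L C q" for x C q
    using that by (auto simp: L_def)
  have L: "L C q \<in> sets borel" if "closed C" for C q
  proof -
    have "L C q = (\<Union>n::nat. fst ` ((G \<inter> fst -` cball 0 (real n)) \<inter> (C \<inter> {p. J p \<le> q})))"
      using real_arch_simple by (force simp: L_def)
    moreover have "compact (fst ` ((G \<inter> fst -` cball 0 (real n)) \<inter> (C \<inter> {p. J p \<le> q})))" for n
      by (intro compact_continuous_image compact_Int_closed[OF cpt] closed_Int that Jc continuous_intros)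
    ultimately show ?thesis
      by (simp only:) (intro sets.countable_UN'' borel_closed, auto intro: compact_imp_closed)
  qed
  \<comment> \<open>A fibre is a closed part of a compact slice of \<open>G\<close>, so a continuous
    cost attains its minimum there.\<close>
  have attained: "\<exists>p\<in>G \<inter> C. fst p = fst p0 \<and> (\<forall>q\<in>G \<inter> C. fst q = fst p0 \<longrightarrow> J p \<le> J q)"
    if "closed C" "p0 \<in> G \<inter> C" for C p0
  proof -
    define S where "S = (G \<inter> fst -` cball 0 (norm (fst p0))) \<inter> (C \<inter> fst -` {fst p0})"
    have "compact S" unfolding S_def
      by (intro compact_Int_closed[OF cpt] closed_Int that(1) closed_vimage continuous_intros)
    moreover have "p0 \<in> S" using that by (auto simp: S_def)
    ultimately obtain p where "p \<in> S" "\<And>q. q \<in> S \<Longrightarrow> J p \<le> J q"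
      using continuous_attains_inf[of S J] J by (metis continuous_on_subset empty_iff subset_UNIV)
    then show ?thesis by (intro bexI[of _ p]) (auto simp: S_def)
  qed
  \<comment> \<open>The union says that the fibre over \<open>x\<close> is nonempty; the
    intersection says that no rational level separates the unrestricted minimum from the restricted
    one.\<close>
  have "{x \<in> fst ` G. \<psi> x \<in> F} = (\<Inter>q\<in>\<rat>. - L UNIV q \<union> L {p. \<pi> p \<in> F} q) \<inter> (\<Union>q\<in>\<rat>. L UNIV q)"
  proof (intro set_eqI iffI)
    fix x assume x: "x \<in> {x \<in> fst ` G. \<psi> x \<in> F}"
    then obtain p0 where "p0 \<in> G" "fst p0 = x" by auto
    then obtain p where p: "p \<in> G" "fst p = x" "\<And>q. q \<in> G \<Longrightarrow> fst q = x \<Longrightarrow> J p \<le> J q"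
      using attained[of UNIV p0] by auto
    then have "\<pi> p \<in> F" using \<psi>[of p] x by auto
    have "x \<in> L {p. \<pi> p \<in> F} q" if "x \<in> L UNIV q" for q
      using LE[OF that] \<open>\<pi> p \<in> F\<close> p(3) by (intro LI[OF p(1) _ _ p(2)]) fastforce+
    moreover obtain q where "q \<in> \<rat>" "J p < q"
      using Rats_dense_in_real[of "J p" "J p + 1"] by auto
    then have "\<exists>q\<in>\<rat>. x \<in> L UNIV q" using LI[OF p(1) UNIV_I _ p(2)] less_imp_le by blast
    ultimately show "x \<in> (\<Inter>q\<in>\<rat>. - L UNIV q \<union> L {p. \<pi> p \<in> F} q) \<inter> (\<Union>q\<in>\<rat>. L UNIV q)" by auto
  next
    fix x assume x: "x \<in> (\<Inter>q\<in>\<rat>. - L UNIV q \<union> L {p. \<pi> p \<in> F} q) \<inter> (\<Union>q\<in>\<rat>. L UNIV q)"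
    then obtain p0 where "p0 \<in> G" "fst p0 = x" using LE by blast
    then obtain p where p: "p \<in> G" "fst p = x" "\<And>q. q \<in> G \<Longrightarrow> fst q = x \<Longrightarrow> J p \<le> J q"
      using attained[of UNIV p0] by auto
    have below: "\<exists>p'\<in>G \<inter> {p. \<pi> p \<in> F}. fst p' = x \<and> J p' \<le> q" if "q \<in> \<rat>" "J p \<le> q" for q
    proof -
      have "x \<in> L UNIV q" by (rule LI[OF p(1) UNIV_I that(2) p(2)])
      then have "x \<in> L {p. \<pi> p \<in> F} q" using x that by auto
      then show ?thesis by (rule LE)
    qed
    \<comment> \<open>One rational level above the minimum shows that the restricted fibre is
      nonempty, so that its minimum exists.\<close>
    obtain q0 where "q0 \<in> \<rat>" "J p < q0"
      using Rats_dense_in_real[of "J p" "J p + 1"] by auto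
    then obtain p1 where "p1 \<in> G \<inter> {p. \<pi> p \<in> F}" "fst p1 = x" using below[of q0] by auto
    then obtain p' where p': "p' \<in> G" "\<pi> p' \<in> F" "fst p' = x"
      "\<And>q. q \<in> G \<Longrightarrow> \<pi> q \<in> F \<Longrightarrow> fst q = x \<Longrightarrow> J p' \<le> J q"
      using attained[OF \<pi>F, of p1] by auto
    have "J p' \<le> J p"
    proof (rule ccontr)
      assume "\<not> J p' \<le> J p"
      then obtain q where q: "q \<in> \<rat>" "J p < q" "q < J p'" using Rats_dense_in_real[of "J p" "J p'"] by auto
      then obtain p'' where "p'' \<in> G \<inter> {p. \<pi> p \<in> F}" "fst p'' = x" "J p'' \<le> q"
        using below[of q] less_imp_le by blast
      then show False using p'(4)[of p''] q by auto
    qed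
    \<comment> \<open>The restricted minimizer is now a minimizer over the whole fibre, and
      \<open>\<pi>\<close> has the same value at all of these.\<close>
    then have "\<pi> p' = \<psi> x" using \<psi>[of p'] p p' by (metis order_trans)
    then have "\<psi> x \<in> F" using p'(2) by simp
    then show "x \<in> {x \<in> fst ` G. \<psi> x \<in> F}" using p(1,2) by blast
  qed
  also have "\<dots> \<in> sets borel"
    using L[OF closed_UNIV] L[OF \<pi>F] countable_rat Rats_0
    by (intro sets.Int sets.countable_INT'' sets.countable_UN'' sets.Un) (auto simp: borel_comp)
  finally show ?thesis .
qed

section \<open>Quadratic forms and nominal trajectories\<close>

lemma pos_def_coercive:
  fixes S :: "real^'n^'n"
  assumes "pos_def S"
  obtains m where "m > 0" "\<And>x. m * (norm x)\<^sup>2 \<le> x \<bullet> (S *v x)"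
proof -
  have c: "continuous_on (sphere 0 1) (\<lambda>x. x \<bullet> (S *v x))"
    by (intro continuous_intros)
  obtain b :: "real^'n" where "norm b = 1" using vector_choose_size[of 1] zero_le_one by blast
  then have "sphere 0 1 \<noteq> ({} :: (real^'n) set)" by (metis mem_sphere_0 empty_iff)
  then obtain u where u: "u \<in> sphere 0 1" "\<And>y. y \<in> sphere 0 1 \<Longrightarrow> u \<bullet> (S *v u) \<le> y \<bullet> (S *v y)"
    using continuous_attains_inf[OF compact_sphere _ c] by blast
  show ?thesis
  proof (rule that[of "u \<bullet> (S *v u)"])
    have "u \<noteq> 0" using u(1) by auto
    then show "u \<bullet> (S *v u) > 0" using assms by (simp add: pos_def_def)
    fix x :: "real^'n"
    show "u \<bullet> (S *v u) * (norm x)\<^sup>2 \<le> x \<bullet> (S *v x)"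
    proof (cases "x = 0")
      case False
      define y where "y = x /\<^sub>R norm x"
      have "y \<in> sphere 0 1" using False by (simp add: y_def)
      then have "u \<bullet> (S *v u) * (norm x)\<^sup>2 \<le> (y \<bullet> (S *v y)) * (norm x)\<^sup>2"
        by (intro mult_right_mono u(2)) auto
      also have "\<dots> = x \<bullet> (S *v x)"
        using False by (simp add: y_def matrix_vector_mult_scaleR power2_eq_square field_simps)
      finally show ?thesis .
    qed simp
  qed
qed

lemma pos_def_nonneg: "pos_def S \<Longrightarrow> 0 \<le> x \<bullet> (S *v x)"
  by (cases "x = 0") (auto simp: pos_def_def less_imp_le)

lemma pos_def_nonpos_imp_zero: "pos_def S \<Longrightarrow> x \<bullet> (S *v x) \<le> 0 \<Longrightarrow> x = 0"
  by (metis linorder_not_le pos_def_def)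

text \<open>Strict convexity in exact form: the value at the midpoint falls short of the mean value
  by the form at half the difference.\<close>

lemma quadratic_form_parallelogram:
  fixes S :: "real^'n^'n"
  shows "((1/2) *\<^sub>R (x + y)) \<bullet> (S *v ((1/2) *\<^sub>R (x + y))) + ((1/2) *\<^sub>R (x - y)) \<bullet> (S *v ((1/2) *\<^sub>R (x - y)))
    = (x \<bullet> (S *v x) + y \<bullet> (S *v y)) / 2"
  by (simp add: matrix_vector_mult_scaleR matrix_vector_right_distrib matrix_vector_mult_diff_distrib
      inner_add inner_diff field_simps)

text \<open>Expressing the predicted states through the initial state and the inputs builds the
  dynamics into the parametrization; what remains are closed conditions on continuous
  functions.\<close>

primrec nominal_state :: "real^'n^'n \<Rightarrow> real^'m^'n \<Rightarrow> real^'n \<Rightarrow> (nat \<Rightarrow> real^'m) \<Rightarrow> nat \<Rightarrow> real^'n" where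
  "nominal_state A B z us 0 = z"
| "nominal_state A B z us (Suc k) = A *v nominal_state A B z us k + B *v us k"

lemma continuous_on_nominal_state:
  assumes "continuous_on S f" "\<And>k. continuous_on S (\<lambda>p. g p k)"
  shows "continuous_on S (\<lambda>p. nominal_state A B (f p) (g p) k)"
proof (induction k)
  case 0
  then show ?case using assms by simp
next
  case (Suc k)
  then show ?case
    using assms(2)[of k] by (auto intro!: continuous_on_add bounded_linear.continuous_on[OF matrix_vector_mul_bounded_linear])
qed

section \<open>The optimal control problem\<close>

text \<open>Collects the properties of the constraint sets behind the deterministic claims; the
  final proof derives them from the system data.\<close>

locale tube_mpc =
  fixes A Q P :: "real^'n^'n" and B :: "real^'m^'n" and K Kb :: "real^'n^'m" and R :: "real^'m^'m"
    and N :: nat and X Xf E W :: "(real^'n) set" and V :: "(real^'m) set"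
  assumes N: "N \<ge> 1"
    and Q: "pos_def Q" and R: "pos_def R" and P: "pos_def P"
    and lyapunov: "transpose (A + B ** Kb) ** P ** (A + B ** Kb) - P = - Q - transpose Kb ** R ** Kb"
    and E: "compact E" "convex E"
    and E_inv: "e \<in> E \<Longrightarrow> w \<in> W \<Longrightarrow> (A + B ** K) *v e + w \<in> E"
    and X: "closed X" "convex X"
    and V: "compact V" "convex V"
    and Xf: "closed Xf" "convex Xf" "Xf \<subseteq> X"
    and Xf_inv: "x \<in> Xf \<Longrightarrow> (A + B ** Kb) *v x \<in> Xf"
    and Xf_input: "x \<in> Xf \<Longrightarrow> Kb *v x \<in> V"
begin

abbreviation constr where "constr \<equiv> smpc_constraints A B N X V Xf E"
abbreviation cost where "cost \<equiv> smpc_cost P Q R N"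
abbreviation feasible where "feasible \<equiv> smpc_feasible A B N X V Xf E"
abbreviation opt where "opt x \<equiv> arg_min cost (constr x)"
abbreviation input where "input \<equiv> smpc_input A B K P Q R N X V Xf E"

lemma constr_iff:
  "constr x (xs, us) \<longleftrightarrow> (\<forall>k<N. xs (Suc k) = A *v xs k + B *v us k) \<and> (\<forall>k\<in>{1..<N}. xs k \<in> X) \<and>
     (\<forall>k<N. us k \<in> V) \<and> xs N \<in> Xf \<and> x - xs 0 \<in> E"
proof -
  have "x \<in> xs 0 +o E \<longleftrightarrow> x - xs 0 \<in> E"
    by (auto simp: elt_set_plus_def intro: bexI[of _ "x - xs 0"])
  then show ?thesis by (simp add: smpc_constraints_def)
qed

lemma cost_ge_stage:
  "xs 0 \<bullet> (Q *v xs 0) + us 0 \<bullet> (R *v us 0) \<le> cost (xs, us)"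
proof -
  have "xs 0 \<bullet> (Q *v xs 0) + us 0 \<bullet> (R *v us 0) \<le> (\<Sum>k<N. xs k \<bullet> (Q *v xs k) + us k \<bullet> (R *v us k))"
    using N by (intro member_le_sum) (auto intro!: add_nonneg_nonneg pos_def_nonneg Q R)
  then show ?thesis using pos_def_nonneg[OF P, of "xs N"] by (simp add: smpc_cost_def)
qed

lemma cost_nonneg: "0 \<le> cost s"
  using cost_ge_stage[of "fst s" "snd s"] pos_def_nonneg[OF Q, of "fst s 0"] pos_def_nonneg[OF R, of "snd s 0"]
  by simp

lemma cost_parallelogram:
  "cost (\<lambda>k. (1/2) *\<^sub>R (xs k + xs' k), \<lambda>k. (1/2) *\<^sub>R (us k + us' k))
    + cost (\<lambda>k. (1/2) *\<^sub>R (xs k - xs' k), \<lambda>k. (1/2) *\<^sub>R (us k - us' k))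
    = (cost (xs, us) + cost (xs', us')) / 2"
proof -
  \<comment> \<open>Adds two identities of the same shape, so that the quadratic forms need not be
    expanded.\<close>
  have combine: "(p + p') + (q + q') = ((r + r') + (s + s')) / 2"
    if "p + q = (r + s) / 2" "p' + q' = (r' + s') / 2" for p p' q q' r r' s s' :: real
    using that by simp
  define a where "a = (\<lambda>k. ((1/2) *\<^sub>R (xs k + xs' k)) \<bullet> (Q *v ((1/2) *\<^sub>R (xs k + xs' k)))
     + ((1/2) *\<^sub>R (us k + us' k)) \<bullet> (R *v ((1/2) *\<^sub>R (us k + us' k))))"
  define b where "b = (\<lambda>k. ((1/2) *\<^sub>R (xs k - xs' k)) \<bullet> (Q *v ((1/2) *\<^sub>R (xs k - xs' k)))
     + ((1/2) *\<^sub>R (us k - us' k)) \<bullet> (R *v ((1/2) *\<^sub>R (us k - us' k))))"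
  define c where "c = (\<lambda>k. xs k \<bullet> (Q *v xs k) + us k \<bullet> (R *v us k))"
  define d where "d = (\<lambda>k. xs' k \<bullet> (Q *v xs' k) + us' k \<bullet> (R *v us' k))"
  have "a k + b k = (c k + d k) / 2" for k
    unfolding a_def b_def c_def d_def by (intro combine quadratic_form_parallelogram)
  then have "(\<Sum>k<N. a k) + (\<Sum>k<N. b k) = ((\<Sum>k<N. c k) + (\<Sum>k<N. d k)) / 2"
    by (simp only: sum.distrib[symmetric] sum_divide_distrib)
  then show ?thesis
    unfolding smpc_cost_def a_def b_def c_def d_def split by (intro combine quadratic_form_parallelogram)
qed

lemma constr_midpoint:
  assumes "constr x (xs, us)" "constr x (xs', us')"
  shows "constr x (\<lambda>k. (1/2) *\<^sub>R (xs k + xs' k), \<lambda>k. (1/2) *\<^sub>R (us k + us' k))"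
proof -
  have mid: "(1/2) *\<^sub>R (a + b) \<in> S" if "convex S" "a \<in> S" "b \<in> S" for a b and S :: "'b::real_vector set"
    using convexD[OF that, of "1/2" "1/2"] by (simp add: scaleR_add_right)
  have e: "x - (1/2) *\<^sub>R (xs 0 + xs' 0) = (1/2) *\<^sub>R ((x - xs 0) + (x - xs' 0))"
    by (simp add: vec_eq_iff field_simps)
  have s: "\<And>k. k < N \<Longrightarrow> xs (Suc k) = A *v xs k + B *v us k" "\<And>k. k \<in> {1..<N} \<Longrightarrow> xs k \<in> X"
    "\<And>k. k < N \<Longrightarrow> us k \<in> V" "xs N \<in> Xf" "x - xs 0 \<in> E"
    and s': "\<And>k. k < N \<Longrightarrow> xs' (Suc k) = A *v xs' k + B *v us' k" "\<And>k. k \<in> {1..<N} \<Longrightarrow> xs' k \<in> X"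
    "\<And>k. k < N \<Longrightarrow> us' k \<in> V" "xs' N \<in> Xf" "x - xs' 0 \<in> E"
    using assms by (auto simp: constr_iff)
  show ?thesis
    unfolding constr_iff e
  proof (intro conjI allI ballI impI mid[OF X(2)] mid[OF V(2)] mid[OF Xf(2)] mid[OF E(2)] s s')
    fix k assume k: "k < N"
    show "(1/2) *\<^sub>R (xs (Suc k) + xs' (Suc k))
      = A *v ((1/2) *\<^sub>R (xs k + xs' k)) + B *v ((1/2) *\<^sub>R (us k + us' k))"
      unfolding s(1)[OF k] s'(1)[OF k]
      by (simp add: matrix_vector_mult_scaleR matrix_vector_right_distrib scaleR_add_right)
  qed auto
qed

text \<open>The midpoint of two minimizers is feasible and cannot cost less, so the parallelogram
  identity leaves a nonpositive cost for half their difference. Definiteness at stage 0 then forces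
  equality of exactly the entries that determine the input.\<close>

lemma minimizer_unique:
  assumes s: "constr x (xs, us)" "\<And>s. constr x s \<Longrightarrow> cost (xs, us) \<le> cost s"
    and s': "constr x (xs', us')" "\<And>s. constr x s \<Longrightarrow> cost (xs', us') \<le> cost s"
  shows "xs 0 = xs' 0 \<and> us 0 = us' 0"
proof -
  have half: "r \<le> 0" if "a = b" "a \<le> m" "m + r = (a + b) / 2" for a b m r :: real
    using that by simp
  have "cost (xs, us) = cost (xs', us')" using s s' by (meson antisym)
  moreover have "cost (xs, us) \<le> cost (\<lambda>k. (1/2) *\<^sub>R (xs k + xs' k), \<lambda>k. (1/2) *\<^sub>R (us k + us' k))"
    by (intro s(2) constr_midpoint s(1) s'(1))
  ultimately have "cost (\<lambda>k. (1/2) *\<^sub>R (xs k - xs' k), \<lambda>k. (1/2) *\<^sub>R (us k - us' k)) \<le> 0"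
    by (rule half) (rule cost_parallelogram)
  then have le: "((1/2) *\<^sub>R (xs 0 - xs' 0)) \<bullet> (Q *v ((1/2) *\<^sub>R (xs 0 - xs' 0)))
      + ((1/2) *\<^sub>R (us 0 - us' 0)) \<bullet> (R *v ((1/2) *\<^sub>R (us 0 - us' 0))) \<le> 0"
    using cost_ge_stage[of "\<lambda>k. (1/2) *\<^sub>R (xs k - xs' k)" "\<lambda>k. (1/2) *\<^sub>R (us k - us' k)"] by linarith
  have nonpos: "a \<le> 0 \<and> b \<le> 0" if "a + b \<le> 0" "0 \<le> a" "0 \<le> b" for a b :: real
    using that by linarith
  have "(1/2) *\<^sub>R (xs 0 - xs' 0) = 0" "(1/2) *\<^sub>R (us 0 - us' 0) = 0"
    using nonpos[OF le pos_def_nonneg[OF Q] pos_def_nonneg[OF R]]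
    by (blast intro: pos_def_nonpos_imp_zero[OF Q] pos_def_nonpos_imp_zero[OF R])+
  then show "xs 0 = xs' 0 \<and> us 0 = us' 0" by simp
qed

text \<open>A point of \<open>decisions\<close> is a triple of measured state, initial error and input sequence that vanishes beyond the
  horizon; the normalization makes the fibres compact.\<close>
definition decisions :: "((real^'n) \<times> (real^'n) \<times> (nat \<Rightarrow> real^'m)) set" where
  "decisions = {p. fst (snd p) \<in> E \<and> (\<forall>k. snd (snd p) k \<in> (if k < N then V else {0})) \<and>
     (\<forall>k\<in>{1..<N}. nominal_state A B (fst p - fst (snd p)) (snd (snd p)) k \<in> X) \<and>
     nominal_state A B (fst p - fst (snd p)) (snd (snd p)) N \<in> Xf}"

definition plan :: "(real^'n) \<times> (real^'n) \<times> (nat \<Rightarrow> real^'m) \<Rightarrow> (nat \<Rightarrow> real^'n) \<times> (nat \<Rightarrow> real^'m)" where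
  "plan p = (nominal_state A B (fst p - fst (snd p)) (snd (snd p)), snd (snd p))"

lemma continuous_on_plan:
  "continuous_on UNIV (\<lambda>p. fst (plan p) k)" "continuous_on UNIV (\<lambda>p. snd (plan p) k)"
proof -
  have c: "continuous_on UNIV (\<lambda>p::(real^'n) \<times> (real^'n) \<times> (nat \<Rightarrow> real^'m). snd (snd p) k)" for k
    by (rule continuous_on_product_then_coordinatewise) (intro continuous_intros)
  show "continuous_on UNIV (\<lambda>p. snd (plan p) k)" using c by (simp add: plan_def)
  show "continuous_on UNIV (\<lambda>p. fst (plan p) k)" unfolding plan_def fst_conv
    by (rule continuous_on_nominal_state[OF _ c]) (intro continuous_intros)
qed

lemma continuous_on_cost_plan: "continuous_on UNIV (\<lambda>p. cost (plan p))"
proof -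
  have "(\<lambda>p. cost (plan p)) = (\<lambda>p. fst (plan p) N \<bullet> (P *v fst (plan p) N)
     + (\<Sum>k<N. fst (plan p) k \<bullet> (Q *v fst (plan p) k) + snd (plan p) k \<bullet> (R *v snd (plan p) k)))"
    by (simp add: smpc_cost_def split_def)
  then show ?thesis
    by (simp only:) (intro continuous_intros continuous_on_plan
        bounded_linear.continuous_on[OF matrix_vector_mul_bounded_linear])
qed

text \<open>A ball, \<open>E\<close> and a product of compact input sets form a compact product; the
  state constraints cut it by preimages of closed sets.\<close>

lemma compact_decisions: "compact (decisions \<inter> fst -` cball 0 r)"
proof -
  have "compact {us. \<forall>k::nat. us k \<in> (if k < N then V else {0})}"
    using V by (intro compact_coordinatewise) auto
  then have "compact (cball (0::real^'n) r \<times> E \<times> {us. \<forall>k. us k \<in> (if k < N then V else {0})})"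
    using E by (intro compact_Times compact_cball)
  moreover have "closed ((\<Inter>k\<in>{1..<N}. (\<lambda>p. fst (plan p) k) -` X) \<inter> (\<lambda>p. fst (plan p) N) -` Xf)"
    by (intro closed_Int closed_INT ballI closed_vimage X Xf continuous_on_plan)
  ultimately have "compact ((cball 0 r \<times> E \<times> {us. \<forall>k. us k \<in> (if k < N then V else {0})}) \<inter>
    ((\<Inter>k\<in>{1..<N}. (\<lambda>p. fst (plan p) k) -` X) \<inter> (\<lambda>p. fst (plan p) N) -` Xf))"
    by (rule compact_Int_closed)
  also have "\<dots> = decisions \<inter> fst -` cball 0 r" by (auto simp: decisions_def plan_def)
  finally show ?thesis .
qed

lemma constr_plan: "p \<in> decisions \<Longrightarrow> constr (fst p) (plan p)"
  by (auto simp: decisions_def plan_def constr_iff split: if_splits)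

text \<open>Zeroing the inputs beyond the horizon affects neither constraints nor cost, so
  minimizing over \<open>decisions\<close> is as good as minimizing over all pairs.\<close>

lemma constr_imp_plan:
  assumes s: "constr x s"
  obtains p where "p \<in> decisions" "fst p = x" "cost (plan p) = cost s"
    "fst (plan p) 0 = fst s 0" "snd (plan p) 0 = snd s 0"
proof -
  obtain xs us where [simp]: "s = (xs, us)" by fastforce
  define us' where "us' = (\<lambda>k. if k < N then us k else 0)"
  have roll: "k \<le> N \<Longrightarrow> nominal_state A B (xs 0) us' k = xs k" for k
    using s by (induction k) (auto simp: constr_iff us'_def)
  define p where "p = (x, x - xs 0, us')"
  show ?thesis
  proof (rule that[of p])
    show "p \<in> decisions" using s roll by (auto simp: decisions_def p_def constr_iff us'_def)
    show "cost (plan p) = cost s" using roll by (simp add: smpc_cost_def plan_def p_def us'_def)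
  qed (use N in \<open>auto simp: p_def plan_def us'_def\<close>)
qed

lemma fst_decisions: "fst ` decisions = {x. feasible x}"
  unfolding smpc_feasible_def using constr_plan by (blast elim: constr_imp_plan)

text \<open>\<open>arg_min\<close> is a choice operator and says nothing until some minimizer
  exists; compactness of the fibre over \<open>x\<close> provides one.\<close>

lemma opt_minimal:
  assumes "feasible x"
  shows "constr x (opt x)" "\<And>s. constr x s \<Longrightarrow> cost (opt x) \<le> cost s"
proof -
  obtain p0 where p0: "p0 \<in> decisions" "fst p0 = x"
    using assms fst_decisions by (metis (mono_tags, lifting) imageE mem_Collect_eq)
  define S where "S = (decisions \<inter> fst -` cball 0 (norm x)) \<inter> fst -` {x}"
  have "compact S" unfolding S_def
    by (intro compact_Int_closed[OF compact_decisions] closed_vimage continuous_intros closed_singleton)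
  moreover have "p0 \<in> S" using p0 by (simp add: S_def)
  moreover have "continuous_on S (\<lambda>p. cost (plan p))"
    using continuous_on_cost_plan by (rule continuous_on_subset) simp
  ultimately obtain p where p: "p \<in> S" "\<And>q. q \<in> S \<Longrightarrow> cost (plan p) \<le> cost (plan q)"
    using continuous_attains_inf[of S "\<lambda>p. cost (plan p)"] by blast
  have min: "cost (plan p) \<le> cost s" if s: "constr x s" for s
  proof -
    obtain q where "q \<in> decisions" "fst q = x" "cost (plan q) = cost s"
      using s by (rule constr_imp_plan)
    then show ?thesis using p(2)[of q] by (simp add: S_def)
  qed
  have "is_arg_min cost (constr x) (plan p)"
    using constr_plan[of p] p(1) min by (auto simp: is_arg_min_def S_def not_less)
  then have "is_arg_min cost (constr x) (opt x)" unfolding arg_min_def by (rule someI)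
  then show "constr x (opt x)" "\<And>s. constr x s \<Longrightarrow> cost (opt x) \<le> cost s"
    by (auto simp: is_arg_min_def not_less)
qed

lemma input_eq: "input x = K *v (x - fst (opt x) 0) + snd (opt x) 0"
  by (simp add: smpc_input_def split_def Let_def)

lemma borel_measurable_input: "input \<in> borel_measurable borel"
proof -
  define \<psi> where "\<psi> = (\<lambda>x. (fst (opt x) 0, snd (opt x) 0))"
  \<comment> \<open>At every infeasible state the constraint is the same constantly false predicate,
    so the choice operator returns this one value.\<close>
  define c where "c = arg_min cost (\<lambda>_. False)"
  have infeasible: "\<psi> x = (fst c 0, snd c 0)" if "\<not> feasible x" for x
  proof -
    have "constr x = (\<lambda>_. False)" using that by (auto simp: smpc_feasible_def)
    then show ?thesis by (simp add: \<psi>_def c_def)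
  qed
  have unique: "(fst (plan p) 0, snd (plan p) 0) = \<psi> (fst p)"
    if p: "p \<in> decisions" and min: "\<And>q. q \<in> decisions \<Longrightarrow> fst q = fst p \<Longrightarrow> cost (plan p) \<le> cost (plan q)" for p
  proof -
    have feas: "feasible (fst p)" using p fst_decisions by blast
    have "cost (plan p) \<le> cost s" if "constr (fst p) s" for s
      using that min by (metis constr_imp_plan)
    then show ?thesis
      using minimizer_unique[of "fst p" "fst (plan p)" "snd (plan p)" "fst (opt (fst p))" "snd (opt (fst p))"]
        constr_plan[OF p] opt_minimal[OF feas] by (simp add: \<psi>_def)
  qed
  have D: "{x. feasible x \<and> \<psi> x \<in> F} \<in> sets borel" if "closed F" for F
  proof -
    have "{x \<in> fst ` decisions. \<psi> x \<in> F} \<in> sets borel"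
    proof (rule borel_unique_minimizer[where J = "\<lambda>p. cost (plan p)"
          and \<pi> = "\<lambda>p. (fst (plan p) 0, snd (plan p) 0)"])
      show "continuous_on UNIV (\<lambda>p. (fst (plan p) 0, snd (plan p) 0))"
        by (intro continuous_on_Pair continuous_on_plan)
    qed (use compact_decisions continuous_on_cost_plan unique that in auto)
    then show ?thesis by (simp add: fst_decisions)
  qed
  have feas: "{x. feasible x} \<in> sets borel" using D[OF closed_UNIV] by simp
  have "\<psi> \<in> borel_measurable borel"
  proof (rule borel_measurableI)
    fix S :: "((real^'n) \<times> (real^'m)) set" assume "open S"
    \<comment> \<open>On the feasible states the preimage of the open \<open>S\<close> is the
      complement of the preimage of a closed set; the infeasible states enter all together or not at
      all.\<close>
    have "\<psi> -` S \<inter> space borel = ({x. feasible x} - {x. feasible x \<and> \<psi> x \<in> - S})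
       \<union> (if (fst c 0, snd c 0) \<in> S then - {x. feasible x} else {})"
    proof (rule set_eqI)
      fix x
      show "x \<in> \<psi> -` S \<inter> space borel \<longleftrightarrow> x \<in> ({x. feasible x} - {x. feasible x \<and> \<psi> x \<in> - S})
       \<union> (if (fst c 0, snd c 0) \<in> S then - {x. feasible x} else {})"
        using infeasible[of x] by (cases "feasible x") auto
    qed
    also have "\<dots> \<in> sets borel"
      using feas D[of "- S"] \<open>open S\<close> by (auto intro: borel_comp)
    finally show "\<psi> -` S \<inter> space borel \<in> sets borel" .
  qed
  note \<psi> = this
  have meas: "(\<lambda>x. fst (\<psi> x)) \<in> borel_measurable borel" "(\<lambda>x. snd (\<psi> x)) \<in> borel_measurable borel"
    by (rule measurable_compose[OF \<psi> borel_measurable_continuous_onI], intro continuous_intros)+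
  have "(\<lambda>x. K *v (x - fst (\<psi> x)) + snd (\<psi> x)) \<in> borel_measurable borel"
    by (intro borel_measurable_add measurable_compose[OF _ borel_measurable_continuous_onI[of "(*v) K"]]
        borel_measurable_diff matrix_vector_mult_linear_continuous_on measurable_ident_sets[OF refl] meas)
  then show ?thesis by (simp add: input_eq[abs_def] \<psi>_def)
qed

end

section \<open>Closed-loop behaviour\<close>

context tube_mpc
begin

text \<open>The Lyapunov equation read as an identity of quadratic forms: the stage cost of the
  terminal controller is exactly the drop in terminal cost.\<close>

lemma terminal_cost_decrease:
  "((A + B ** Kb) *v x) \<bullet> (P *v ((A + B ** Kb) *v x)) + (x \<bullet> (Q *v x) + (Kb *v x) \<bullet> (R *v (Kb *v x)))
    = x \<bullet> (P *v x)"
proof -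
  have adj: "x \<bullet> (transpose F *v y) = (F *v x) \<bullet> y" for F :: "real^'c^'d" and x y
    by (metis dot_lmul_matrix inner_commute transpose_matrix_vector)
  have quad: "x \<bullet> ((transpose F ** S ** F) *v x) = (F *v x) \<bullet> (S *v (F *v x))"
    for F :: "real^'c^'d" and S x
    unfolding matrix_vector_mul_assoc[symmetric] adj ..
  have "x \<bullet> ((transpose (A + B ** Kb) ** P ** (A + B ** Kb) - P) *v x)
      = x \<bullet> ((- Q - transpose Kb ** R ** Kb) *v x)"
    by (simp add: lyapunov)
  moreover have "(- Q) *v x = - (Q *v x)"
    by (simp add: matrix_vector_mult_def vec_eq_iff sum_negf)
  ultimately show ?thesis
    by (simp add: matrix_vector_mult_diff_rdistrib inner_diff_right quad)
qed

text \<open>All five facts rest on one split of the successor state: a nominal part fixed by the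
  plan and an error part carrying the noise.\<close>

lemma
  assumes x: "feasible x" and w: "w \<in> W"
  shows initial_error: "x - fst (opt x) 0 \<in> E"
    and predicted_state: "fst (opt x) 1 \<in> X"
    and successor: "A *v x + B *v input x + w = fst (opt x) 1 + ((A + B ** K) *v (x - fst (opt x) 0) + w)"
    and successor_feasible: "feasible (A *v x + B *v input x + w)"
    and cost_decrease: "fst (opt x) 0 \<bullet> (Q *v fst (opt x) 0) + cost (opt (A *v x + B *v input x + w)) \<le> cost (opt x)"
proof -
  obtain xs us where o: "opt x = (xs, us)" by fastforce
  obtain n where n: "N = Suc n" using N by (cases N) auto
  define x' where "x' = A *v x + B *v input x + w"
  have c: "\<And>k. k < N \<Longrightarrow> xs (Suc k) = A *v xs k + B *v us k" "\<And>k. k \<in> {1..<N} \<Longrightarrow> xs k \<in> X"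
    "\<And>k. k < N \<Longrightarrow> us k \<in> V" "xs N \<in> Xf" "x - xs 0 \<in> E"
    using opt_minimal(1)[OF x] by (auto simp: constr_iff o)
  show "x - fst (opt x) 0 \<in> E" using c(5) o by simp
  \<comment> \<open>The constraints impose membership in \<open>X\<close> only before
    \<open>N\<close>; at \<open>N\<close> it follows from \<open>Xf \<subseteq> X\<close>. This
    covers the index 1 even when \<open>N = 1\<close>.\<close>
  have XN: "xs k \<in> X" if "1 \<le> k" "k \<le> N" for k
    using c(2)[of k] c(4) Xf(3) that by (cases "k = N") auto
  then show "fst (opt x) 1 \<in> X" using N o by simp
  have xs1: "xs 1 = A *v xs 0 + B *v us 0" using c(1)[of 0] N by simp
  have succ: "x' = xs 1 + ((A + B ** K) *v (x - xs 0) + w)"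
    unfolding xs1 by (simp add: x'_def input_eq o matrix_vector_mult_add_rdistrib matrix_vector_right_distrib
        matrix_vector_mult_diff_distrib matrix_vector_mul_assoc[symmetric] algebra_simps
        del: matrix_vector_mul_assoc)
  then show "A *v x + B *v input x + w = fst (opt x) 1 + ((A + B ** K) *v (x - fst (opt x) 0) + w)"
    by (simp add: x'_def o)
  define xs' where "xs' = (\<lambda>k. if k < N then xs (Suc k) else (A + B ** Kb) *v xs N)"
  \<comment> \<open>The inputs switch at \<open>n\<close>, one index before the states: the last
    shifted state is \<open>xs N\<close>, and the terminal controller acts from there.\<close>
  define us' where "us' = (\<lambda>k. if k < n then us (Suc k) else Kb *v xs N)"
  have "xs' (Suc k) = A *v xs' k + B *v us' k" if "k < N" for k
  proof (cases "k < n")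
    case True
    then show ?thesis using c(1)[of "Suc k"] by (simp add: xs'_def us'_def n)
  next
    case False
    then have "k = n" using that n by simp
    then show ?thesis
      by (simp add: xs'_def us'_def n matrix_vector_mult_add_rdistrib matrix_vector_mul_assoc)
  qed
  moreover have "xs' k \<in> X" if "k \<in> {1..<N}" for k using XN[of "Suc k"] that by (simp add: xs'_def)
  moreover have "us' k \<in> V" if "k < N" for k
    using c(3)[of "Suc k"] Xf_input[OF c(4)] by (simp add: us'_def n)
  moreover have "xs' N \<in> Xf" using Xf_inv[OF c(4)] by (simp add: xs'_def)
  moreover have "x' - xs' 0 \<in> E" using E_inv[OF c(5) w] N by (simp add: xs'_def succ)
  ultimately have feas': "constr x' (xs', us')" by (simp add: constr_iff)
  then have "feasible x'" by (auto simp: smpc_feasible_def)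
  then show "feasible (A *v x + B *v input x + w)" by (simp add: x'_def)
  have "cost (opt x') \<le> cost (xs', us')" by (rule opt_minimal(2)[OF \<open>feasible x'\<close> feas'])
  moreover define l where "l = (\<lambda>k. xs k \<bullet> (Q *v xs k) + us k \<bullet> (R *v us k))"
  have "cost (xs, us) = xs N \<bullet> (P *v xs N) + (l 0 + (\<Sum>k<n. l (Suc k)))"
    by (simp add: smpc_cost_def n l_def sum.lessThan_Suc_shift del: sum.lessThan_Suc)
  moreover have "cost (xs', us') = ((A + B ** Kb) *v xs N) \<bullet> (P *v ((A + B ** Kb) *v xs N))
      + ((\<Sum>k<n. l (Suc k)) + (xs N \<bullet> (Q *v xs N) + (Kb *v xs N) \<bullet> (R *v (Kb *v xs N))))"
    by (simp add: smpc_cost_def n l_def xs'_def us'_def)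
  \<comment> \<open>The stages common to both plans cancel, and the terminal identity removes
    everything at \<open>xs N\<close>.\<close>
  ultimately have "cost (opt x') + l 0 \<le> cost (opt x)"
    using terminal_cost_decrease[of "xs N"] o by simp
  then show "fst (opt x) 0 \<bullet> (Q *v fst (opt x) 0) + cost (opt (A *v x + B *v input x + w)) \<le> cost (opt x)"
    using pos_def_nonneg[OF R, of "us 0"] by (simp add: x'_def l_def o)
qed

abbreviation state where "state \<equiv> closed_loop A B input"

lemma closed_loop_feasible:
  assumes "feasible x0" "\<And>t. v t \<in> W"
  shows "feasible (state x0 v t)"
  using assms by (induction t) (auto intro: successor_feasible)

text \<open>The optimal costs decrease and are nonnegative, so their decrements vanish; by
  coercivity of \<open>Q\<close> the decrements dominate a multiple of the squared norm.\<close>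

lemma nominal_initial_state_tendsto_zero:
  assumes x0: "feasible x0" and v: "\<And>t. v t \<in> W"
  shows "(\<lambda>t. fst (opt (state x0 v t)) 0) \<longlonglongrightarrow> 0"
proof -
  define z where "z = (\<lambda>t. fst (opt (state x0 v t)) 0)"
  define c where "c = (\<lambda>t. cost (opt (state x0 v t)))"
  have dec: "z t \<bullet> (Q *v z t) \<le> c t - c (Suc t)" for t
    using cost_decrease[OF closed_loop_feasible[OF x0, of v t, OF v] v[of t]] by (simp add: z_def c_def)
  have "decseq c"
    using dec pos_def_nonneg[OF Q] by (intro decseq_SucI) (smt (verit))
  moreover have "\<And>t. 0 \<le> c t" unfolding c_def by (rule cost_nonneg)
  ultimately obtain L where "c \<longlonglongrightarrow> L" using decseq_convergent by metis
  then have "(\<lambda>t. c t - c (Suc t)) \<longlonglongrightarrow> L - L" by (intro tendsto_diff LIMSEQ_Suc)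
  then have c0: "(\<lambda>t. c t - c (Suc t)) \<longlonglongrightarrow> 0" by simp
  obtain m where m: "m > 0" "\<And>x. m * (norm x)\<^sup>2 \<le> x \<bullet> (Q *v x)" using pos_def_coercive[OF Q] by blast
  have "(\<lambda>t. (c t - c (Suc t)) / m) \<longlonglongrightarrow> 0" using tendsto_divide[OF c0 tendsto_const[of m]] m by simp
  moreover have "\<forall>\<^sub>F t in sequentially. norm ((norm (z t))\<^sup>2) \<le> (c t - c (Suc t)) / m"
    using m dec by (intro always_eventually allI) (simp add: pos_le_divide_eq mult.commute, metis order_trans mult.commute)
  ultimately have "(\<lambda>t. (norm (z t))\<^sup>2) \<longlonglongrightarrow> 0" by (rule Lim_null_comparison[rotated])
  then have "(\<lambda>t. norm (z t)) \<longlonglongrightarrow> 0" using tendsto_real_sqrt by fastforce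
  then show ?thesis unfolding z_def by (rule tendsto_norm_zero_cancel)
qed

end

text \<open>A metric with the usual topology need not be uniformly comparable to the norm on the
  whole space. The distance to \<open>S\<close> is continuous, hence uniformly continuous on a
  compact neighbourhood of \<open>S\<close>, and it vanishes on \<open>S\<close>.\<close>

lemma infdist_metric_tendsto_zero:
  fixes d :: "'a::euclidean_space \<Rightarrow> 'a \<Rightarrow> real"
  assumes d: "Metric_space UNIV d" and top: "Metric_space.mtopology UNIV d = euclidean"
    and S: "compact S" and e: "\<And>t. e t \<in> S" and lim: "(\<lambda>t. x t - e t) \<longlonglongrightarrow> 0"
  shows "(\<lambda>t. INF s\<in>S. d (x t) s) \<longlonglongrightarrow> 0"
proof -
  interpret d: Metric_space UNIV d by (rule d)
  define \<phi> where "\<phi> = (\<lambda>x. INF s\<in>S. d x s)"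
  have ne: "S \<noteq> {}" using e by blast
  have bdd: "bdd_below (d x ` S)" for x by (rule bdd_belowI2[of _ 0]) (rule d.nonneg)
  have lip: "\<phi> x \<le> d x y + \<phi> y" for x y
  proof -
    have "\<phi> x - d x y \<le> d y s" if "s \<in> S" for s
      using cINF_lower[OF bdd that, of x] d.triangle[of x y s] by (simp add: \<phi>_def)
    then have "\<phi> x - d x y \<le> \<phi> y" unfolding \<phi>_def[of, THEN fun_cong, of y] by (intro cINF_greatest ne)
    then show ?thesis by simp
  qed
  have "\<phi> s = 0" if "s \<in> S" for s
  proof (rule antisym)
    show "\<phi> s \<le> 0" using cINF_lower[OF bdd that, of s] by (simp add: \<phi>_def)
    show "0 \<le> \<phi> s" unfolding \<phi>_def by (intro cINF_greatest ne d.nonneg)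
  qed
  note zero = this
  have "continuous_on UNIV \<phi>"
    unfolding continuous_on_sequentially
  proof (intro allI ballI impI, elim conjE)
    fix y :: "nat \<Rightarrow> 'a" and a assume y: "y \<longlonglongrightarrow> a"
    have "(\<lambda>n. d (y n) a) \<longlonglongrightarrow> 0"
    proof (rule LIMSEQ_I)
      fix r :: real assume "r > 0"
      have "limitin d.mtopology y a sequentially" using y by (simp add: top)
      then show "\<exists>no. \<forall>n\<ge>no. norm (d (y n) a - 0) < r"
        using \<open>r > 0\<close> by (auto simp: d.limitin_metric eventually_sequentially)
    qed
    moreover have "\<forall>\<^sub>F n in sequentially. norm (\<phi> (y n) - \<phi> a) \<le> d (y n) a"
    proof (rule always_eventually, rule allI)
      fix n show "norm (\<phi> (y n) - \<phi> a) \<le> d (y n) a"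
      using lip[of "y n" a] lip[of a "y n"] d.commute[of a "y n"] by (simp add: abs_le_iff)
    qed
    ultimately have "(\<lambda>n. \<phi> (y n) - \<phi> a) \<longlonglongrightarrow> 0" by (rule Lim_null_comparison[rotated])
    then show "(\<phi> \<circ> y) \<longlonglongrightarrow> \<phi> a" unfolding comp_def using LIM_zero_iff by blast
  qed
  \<comment> \<open>The closed unit neighbourhood of \<open>S\<close>; the sequence lies in it from
    some time \<open>t0\<close> on, hence the shift below.\<close>
  moreover define T where "T = {a + b |a b. a \<in> S \<and> b \<in> cball 0 (1::real)}"
  have cT: "compact T" unfolding T_def by (intro compact_sums S compact_cball)
  ultimately have unif: "uniformly_continuous_on T \<phi>"
    using compact_uniformly_continuous continuous_on_subset by blast
  obtain t0 where t0: "\<And>t. t \<ge> t0 \<Longrightarrow> norm (x t - e t) < 1"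
    using LIMSEQ_D[OF lim, of 1] by auto
  have "x (t + t0) \<in> T \<and> e (t + t0) \<in> T" for t
  proof -
    have "x (t + t0) = e (t + t0) + (x (t + t0) - e (t + t0))" "e (t + t0) = e (t + t0) + 0" by simp_all
    moreover have "x (t + t0) - e (t + t0) \<in> cball 0 1" using t0[of "t + t0"] by simp
    moreover have "(0::'a) \<in> cball 0 1" by simp
    ultimately show ?thesis unfolding T_def using e by blast
  qed
  moreover have "(\<lambda>t. dist (x (t + t0)) (e (t + t0))) \<longlonglongrightarrow> 0"
    using LIMSEQ_ignore_initial_segment[OF tendsto_norm_zero[OF lim], of t0] by (simp add: dist_norm)
  ultimately have "(\<lambda>t. dist (\<phi> (x (t + t0))) (\<phi> (e (t + t0)))) \<longlonglongrightarrow> 0"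
    using unif[unfolded uniformly_continuous_on_sequentially, rule_format, of "\<lambda>t. x (t + t0)" "\<lambda>t. e (t + t0)"]
    by blast
  then have "(\<lambda>t. \<phi> (x (t + t0))) \<longlonglongrightarrow> 0"
    using zero[OF e] by (simp add: tendsto_rabs_zero_iff)
  then have "(\<lambda>t. \<phi> (x t)) \<longlonglongrightarrow> 0" by (rule LIMSEQ_offset)
  then show ?thesis by (simp add: \<phi>_def)
qed

text \<open>Cantelli's inequality: Markov's inequality for \<open>(X + u)\<^sup>2\<close> with the optimal shift \<open>u = Var X / c\<close>
  at the threshold \<open>c\<close>.\<close>
lemma (in prob_space) cantelli_zero_mean:
  fixes X :: "'a \<Rightarrow> real"
  assumes X[measurable]: "X \<in> borel_measurable M" and int: "integrable M X" "integrable M (\<lambda>\<omega>. (X \<omega>)\<^sup>2)"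
    and mean: "expectation X = 0" and \<alpha>: "0 < \<alpha>" "\<alpha> < 1"
  shows "1 - \<alpha> \<le> prob {\<omega> \<in> space M. X \<omega> \<le> sqrt ((1 - \<alpha>) / \<alpha>) * sqrt (expectation (\<lambda>\<omega>. (X \<omega>)\<^sup>2))}"
proof -
  define v where "v = expectation (\<lambda>\<omega>. (X \<omega>)\<^sup>2)"
  have "v \<ge> 0" unfolding v_def by (intro integral_nonneg_AE) auto
  show ?thesis
  proof (cases "v = 0")
    \<comment> \<open>The threshold is 0 here and \<open>X\<close> vanishes almost surely; the shift
      in the other case divides by a positive threshold.\<close>
    case True
    then have "AE \<omega> in M. (X \<omega>)\<^sup>2 = 0"
      using integral_nonneg_eq_0_iff_AE[OF int(2)] by (simp add: v_def)
    then have "AE \<omega> in M. X \<omega> \<le> 0" by eventually_elim simp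
    then have "prob {\<omega> \<in> space M. X \<omega> \<le> 0} = 1" by (subst prob_Collect_eq_1) auto
    then show ?thesis using True \<alpha> by (simp add: v_def)
  next
    case False
    then have v: "v > 0" using \<open>v \<ge> 0\<close> by simp
    define c where "c = sqrt ((1 - \<alpha>) / \<alpha>) * sqrt v"
    define u where "u = v / c"
    have c: "c > 0" "c\<^sup>2 = (1 - \<alpha>) / \<alpha> * v" using v \<alpha> by (auto simp: c_def power_mult_distrib)
    have u: "u > 0" using v c by (simp add: u_def)
    have uu: "u\<^sup>2 = \<alpha> / (1 - \<alpha>) * v" using c v \<alpha> unfolding u_def power_divide c(2)
      by (simp add: field_simps power2_eq_square)
    have "c * u = v" using c by (simp add: u_def)
    then have "(c + u)\<^sup>2 = (1 - \<alpha>) / \<alpha> * v + 2 * v + \<alpha> / (1 - \<alpha>) * v"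
      by (simp add: power2_sum c uu)
    also have "\<dots> = v / (\<alpha> * (1 - \<alpha>))" using \<alpha> by (simp add: field_simps power2_eq_square)
    finally have cu: "(c + u)\<^sup>2 = v / (\<alpha> * (1 - \<alpha>))" .
    have vu: "v + u\<^sup>2 = v / (1 - \<alpha>)" unfolding uu using \<alpha> by (simp add: field_simps)
    have sq: "(X \<omega> + u)\<^sup>2 = (X \<omega>)\<^sup>2 + (2 * u * X \<omega> + u\<^sup>2)" for \<omega> by (simp add: power2_sum)
    have "expectation (\<lambda>\<omega>. (X \<omega> + u)\<^sup>2) = v + u\<^sup>2"
      unfolding sq using int mean by (simp add: v_def prob_space)
    moreover have "integrable M (\<lambda>\<omega>. (X \<omega> + u)\<^sup>2)" unfolding sq using int by simp
    ultimately have "prob {\<omega> \<in> space M. (c + u)\<^sup>2 \<le> (X \<omega> + u)\<^sup>2} \<le> (v + u\<^sup>2) / (c + u)\<^sup>2"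
      using integral_Markov_inequality_measure[of M "\<lambda>\<omega>. (X \<omega> + u)\<^sup>2" "space M" "(c + u)\<^sup>2"] c u by simp
    \<comment> \<open>With the chosen shift the Markov quotient is exactly the admissible
      risk.\<close>
    also have "\<dots> = \<alpha>" unfolding cu vu using v \<alpha> by simp
    finally have tail: "prob {\<omega> \<in> space M. (c + u)\<^sup>2 \<le> (X \<omega> + u)\<^sup>2} \<le> \<alpha>" .
    \<comment> \<open>Squaring preserves the inequality because \<open>c + u\<close> is
      positive.\<close>
    have "prob {\<omega> \<in> space M. \<not> X \<omega> \<le> c} \<le> prob {\<omega> \<in> space M. (c + u)\<^sup>2 \<le> (X \<omega> + u)\<^sup>2}"
      using c u by (intro finite_measure_mono) (auto intro!: power_mono)
    moreover have "prob {\<omega> \<in> space M. \<not> X \<omega> \<le> c} = 1 - prob {\<omega> \<in> space M. X \<omega> \<le> c}"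
      by (intro prob_neg) auto
    ultimately show ?thesis using tail by (simp add: c_def v_def)
  qed
qed

section \<open>Chance constraints\<close>

context prob_space
begin

lemma integral_inner_bounded:
  fixes w :: "'a \<Rightarrow> real^'n"
  assumes w: "w \<in> borel_measurable M" and bound: "AE \<omega> in M. norm (w \<omega>) \<le> b"
  shows "integrable M (\<lambda>\<omega>. v \<bullet> w \<omega>)" "integrable M (\<lambda>\<omega>. (v \<bullet> w \<omega>)\<^sup>2)"
    "expectation (\<lambda>\<omega>. v \<bullet> w \<omega>) = v \<bullet> expectation w"
    "expectation (\<lambda>\<omega>. (v \<bullet> w \<omega>)\<^sup>2) = v \<bullet> ((\<chi> i j. expectation (\<lambda>\<omega>. w \<omega> $ i * w \<omega> $ j)) *v v)"
proof -
  note [measurable] = w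
  have "integrable M w" using bound by (intro integrable_const_bound[of _ b]) auto
  then show "integrable M (\<lambda>\<omega>. v \<bullet> w \<omega>)" "expectation (\<lambda>\<omega>. v \<bullet> w \<omega>) = v \<bullet> expectation w"
    by auto
  have nth: "(\<lambda>\<omega>. w \<omega> $ i) \<in> borel_measurable M" for i
    using measurable_compose[OF w borel_measurable_continuous_onI[of "\<lambda>x. x $ i"]]
    by (simp add: continuous_intros)
  note [measurable] = nth
  have int: "integrable M (\<lambda>\<omega>. w \<omega> $ i * w \<omega> $ j)" for i j
  proof (rule integrable_const_bound[of _ "b * b"])
    show "AE \<omega> in M. norm (w \<omega> $ i * w \<omega> $ j) \<le> b * b"
      using bound
    proof eventually_elim
      fix \<omega> assume "norm (w \<omega>) \<le> b"
      then have "\<bar>w \<omega> $ i\<bar> \<le> b" "\<bar>w \<omega> $ j\<bar> \<le> b"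
        using component_le_norm_cart order_trans by blast+
      then show "norm (w \<omega> $ i * w \<omega> $ j) \<le> b * b" by (simp add: abs_mult mult_mono')
    qed
  qed measurable
  have sq: "(v \<bullet> w \<omega>)\<^sup>2 = (\<Sum>i\<in>UNIV. \<Sum>j\<in>UNIV. v $ i * v $ j * (w \<omega> $ i * w \<omega> $ j))" for \<omega>
    by (simp add: inner_vec_def power2_eq_square sum_product mult_ac)
  show "integrable M (\<lambda>\<omega>. (v \<bullet> w \<omega>)\<^sup>2)"
    unfolding sq by (intro Bochner_Integration.integrable_sum integrable_mult_right int)
  have "expectation (\<lambda>\<omega>. (v \<bullet> w \<omega>)\<^sup>2)
      = (\<Sum>i\<in>UNIV. \<Sum>j\<in>UNIV. v $ i * v $ j * expectation (\<lambda>\<omega>. w \<omega> $ i * w \<omega> $ j))"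
    unfolding sq by (simp add: int Bochner_Integration.integral_sum)
  also have "\<dots> = v \<bullet> ((\<chi> i j. expectation (\<lambda>\<omega>. w \<omega> $ i * w \<omega> $ j)) *v v)"
    by (simp add: inner_vec_def matrix_vector_mult_def sum_distrib_left mult_ac)
  finally show "expectation (\<lambda>\<omega>. (v \<bullet> w \<omega>)\<^sup>2)
    = v \<bullet> ((\<chi> i j. expectation (\<lambda>\<omega>. w \<omega> $ i * w \<omega> $ j)) *v v)" .
qed

text \<open>Cantelli's inequality yields the variance bound with the required probability. The
  \<open>\<Sum>\<close> bound holds almost surely by duality of the 1-norm and the max-norm, so
  taking the minimum costs only a null set.\<close>

lemma bounded_noise_quantile:
  fixes w :: "'a \<Rightarrow> real^'n"
  assumes w[measurable]: "w \<in> borel_measurable M" and bound: "AE \<omega> in M. infnorm (w \<omega>) \<le> a"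
    and mean: "expectation w = 0" and \<alpha>: "0 < \<alpha>" "\<alpha> < 1"
  shows "1 - \<alpha> \<le> prob {\<omega> \<in> space M. v \<bullet> w \<omega> \<le> min ((\<Sum>i\<in>UNIV. \<bar>v $ i\<bar>) * a)
    (sqrt ((1 - \<alpha>) / \<alpha>) * sqrt (v \<bullet> ((\<chi> i j. expectation (\<lambda>\<omega>. w \<omega> $ i * w \<omega> $ j)) *v v)))}"
proof -
  have nb: "AE \<omega> in M. norm (w \<omega>) \<le> sqrt (real DIM(real^'n)) * a"
    using bound
  proof eventually_elim
    fix \<omega> assume "infnorm (w \<omega>) \<le> a"
    then show "norm (w \<omega>) \<le> sqrt (real DIM(real^'n)) * a"
      by (intro order_trans[OF norm_le_infnorm mult_left_mono]) auto
  qed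
  define c where "c = sqrt ((1 - \<alpha>) / \<alpha>)
     * sqrt (v \<bullet> ((\<chi> i j. expectation (\<lambda>\<omega>. w \<omega> $ i * w \<omega> $ j)) *v v))"
  have "1 - \<alpha> \<le> prob {\<omega> \<in> space M. v \<bullet> w \<omega> \<le> c}"
    using cantelli_zero_mean[of "\<lambda>\<omega>. v \<bullet> w \<omega>" \<alpha>] integral_inner_bounded[OF w nb, of v] mean \<alpha>
    by (simp add: c_def)
  also have "\<dots> \<le> prob {\<omega> \<in> space M. v \<bullet> w \<omega> \<le> min ((\<Sum>i\<in>UNIV. \<bar>v $ i\<bar>) * a) c}"
  proof (rule finite_measure_mono_AE)
    show "AE \<omega> in M. \<omega> \<in> {\<omega> \<in> space M. v \<bullet> w \<omega> \<le> c}
       \<longrightarrow> \<omega> \<in> {\<omega> \<in> space M. v \<bullet> w \<omega> \<le> min ((\<Sum>i\<in>UNIV. \<bar>v $ i\<bar>) * a) c}"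
      using bound
    proof eventually_elim
      fix \<omega> assume le: "infnorm (w \<omega>) \<le> a"
      have "v \<bullet> w \<omega> \<le> (\<Sum>i\<in>UNIV. \<bar>v $ i\<bar> * a)"
        unfolding inner_vec_def
      proof (rule sum_mono)
        fix i
        have "\<bar>w \<omega> $ i\<bar> \<le> a" using component_le_infnorm_cart[of "w \<omega>" i] le by linarith
        then have "\<bar>v $ i\<bar> * \<bar>w \<omega> $ i\<bar> \<le> \<bar>v $ i\<bar> * a" by (intro mult_left_mono) auto
        then show "v $ i \<bullet> w \<omega> $ i \<le> \<bar>v $ i\<bar> * a"
          using abs_ge_self[of "v $ i * w \<omega> $ i"] by (simp add: abs_mult)
      qed
      then show "\<omega> \<in> {\<omega> \<in> space M. v \<bullet> w \<omega> \<le> c}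
         \<longrightarrow> \<omega> \<in> {\<omega> \<in> space M. v \<bullet> w \<omega> \<le> min ((\<Sum>i\<in>UNIV. \<bar>v $ i\<bar>) * a) c}"
        by (simp add: sum_distrib_right)
    qed
  qed measurable
  finally show ?thesis by (simp add: c_def)
qed

end

lemma borel_measurable_closed_loop:
  fixes A :: "real^'n^'n" and B :: "real^'m^'n"
  assumes w: "\<And>t. w t \<in> borel_measurable M" and \<kappa>: "\<kappa> \<in> borel_measurable borel"
  shows "(\<lambda>\<omega>. closed_loop A B \<kappa> x0 (\<lambda>s. w s \<omega>) t) \<in> borel_measurable M"
proof (induction t)
  case 0
  then show ?case by simp
next
  case (Suc t)
  have mult: "(*v) S \<in> borel_measurable borel" for S :: "real^'c^'d"
    by (intro borel_measurable_continuous_onI matrix_vector_mult_linear_continuous_on)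
  show ?case
    unfolding closed_loop.simps
    by (intro borel_measurable_add measurable_compose[OF Suc mult]
        measurable_compose[OF measurable_compose[OF Suc \<kappa>] mult] w)
qed

text \<open>Feasibility and convergence are stated for every noise sequence in \<open>W\<close>. At
  \<open>t = 0\<close> the state is deterministic and the problem constrains predictions only from
  \<open>k = 1\<close> on, so the chance constraint there amounts to
  \<open>g j \<bullet> x0 \<le> h j\<close>; hence the disjunction. A distance function is read as a
  metric inducing the usual topology.\<close>

theorem theorem1:
  fixes A Q P Acl Aclb \<Sigma>w :: "real^'n^'n" and B :: "real^'m^'n" and K Kb :: "real^'n^'m"
    and R :: "real^'m^'m" and N nx :: nat and aw :: real
    and W E XS XfS :: "(real^'n) set" and U V :: "(real^'m) set"
    and g :: "nat \<Rightarrow> real^'n" and h \<alpha> \<gamma> :: "nat \<Rightarrow> real"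
    and M :: "'a measure" and w :: "nat \<Rightarrow> 'a \<Rightarrow> real^'n" and x0 :: "real^'n"
    and \<kappa> :: "real^'n \<Rightarrow> real^'m" and d :: "real^'n \<Rightarrow> real^'n \<Rightarrow> real"
  assumes aw: "aw > 0" and W: "W = {v. infnorm v \<le> aw}"
    and prob: "prob_space M"
    and indep: "prob_space.indep_vars M (\<lambda>_. borel) w UNIV"
    and ident: "\<And>t. distr M borel (w t) = distr M borel (w 0)"
    and supp: "\<And>t. AE \<omega> in M. w t \<omega> \<in> W"
    and mean: "integral\<^sup>L M (w 0) = 0"
    and cov: "\<Sigma>w = (\<chi> i j. integral\<^sup>L M (\<lambda>\<omega>. w 0 \<omega> $ i * w 0 \<omega> $ j))"
    and U: "polytope U" "0 \<in> U"
    and alpha: "\<And>j. j \<in> {1..nx} \<Longrightarrow> 0 < \<alpha> j \<and> \<alpha> j < 1"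
    and QR: "pos_def Q" "pos_def R"
    and N: "N \<ge> 1"
    and Acl: "Acl = A + B ** K" "stable_matrix Acl"
    and Aclb: "Aclb = A + B ** Kb" "stable_matrix Aclb"
    and P: "pos_def P" "transpose Aclb ** P ** Aclb - P = - Q - transpose Kb ** R ** Kb"
    and E: "min_robust_invariant Acl W E"
    and gamma: "\<And>j. j \<in> {1..nx} \<Longrightarrow> \<gamma> j = (SUP e\<in>E. g j \<bullet> (Acl *v e))"
    and XS: "XS = tightened_states nx g h \<alpha> \<gamma> aw \<Sigma>w"
    and V: "V = pontryagin_diff U ((\<lambda>e. K *v e) ` E)"
    and XfS: "max_admissible_invariant Aclb Kb XS V XfS"
    and kappa: "\<kappa> = smpc_input A B K P Q R N XS V XfS E"
    and d: "Metric_space UNIV d" "Metric_space.mtopology UNIV d = euclidean"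
    and feasible0: "smpc_feasible A B N XS V XfS E x0"
  shows "(\<forall>v. (\<forall>t. v t \<in> W) \<longrightarrow> (\<forall>t. smpc_feasible A B N XS V XfS E (closed_loop A B \<kappa> x0 v t)))
    \<and> (\<forall>t. \<forall>j\<in>{1..nx}. t \<ge> 1 \<or> g j \<bullet> x0 \<le> h j \<longrightarrow>
         measure M {\<omega> \<in> space M. g j \<bullet> closed_loop A B \<kappa> x0 (\<lambda>s. w s \<omega>) t \<le> h j} \<ge> 1 - \<alpha> j)
    \<and> (\<forall>v. (\<forall>t. v t \<in> W) \<longrightarrow> (\<lambda>t. INF e\<in>E. d (closed_loop A B \<kappa> x0 v t) e) \<longlonglongrightarrow> 0)"
proof -
  interpret prob_space M by (rule prob)
  have W_compact: "compact W"
    unfolding W compact_eq_bounded_closed bounded_iff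
  proof (intro conjI exI[of _ "sqrt (real DIM(real^'n)) * aw"] ballI)
    fix v :: "real^'n" assume "v \<in> {v. infnorm v \<le> aw}"
    then show "norm v \<le> sqrt (real DIM(real^'n)) * aw"
      by (intro order_trans[OF norm_le_infnorm mult_left_mono]) auto
  next
    show "closed {v::real^'n. infnorm v \<le> aw}" by (intro closed_Collect_le continuous_intros)
  qed
  have W_convex: "convex W"
  proof (rule convexI)
    fix x y :: "real^'n" and p q :: real
    assume *: "x \<in> W" "y \<in> W" "0 \<le> p" "0 \<le> q" "p + q = 1"
    have "infnorm (p *\<^sub>R x + q *\<^sub>R y) \<le> p * infnorm x + q * infnorm y"
      using infnorm_triangle[of "p *\<^sub>R x" "q *\<^sub>R y"] * by (simp add: infnorm_mul)
    also have "\<dots> \<le> p * aw + q * aw" using * by (intro add_mono mult_left_mono) (auto simp: W)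
    also have "\<dots> = aw" using * by (simp add: distrib_right[symmetric])
    finally show "p *\<^sub>R x + q *\<^sub>R y \<in> W" by (simp add: W)
  qed
  have "(0::real^'n) \<in> W" using aw by (simp add: W infnorm_0)
  then have W_nonempty: "W \<noteq> {}" by blast
  have E_compact: "compact E"
    using min_robust_invariant_compact[OF Acl(2) compact_imp_bounded[OF W_compact] W_nonempty E] .
  have E_inv: "robust_invariant Acl W E" using E by (simp add: min_robust_invariant_def)
  then have E_nonempty: "E \<noteq> {}" by (simp add: robust_invariant_def)
  have XS': "closed XS" "convex XS" by (simp_all add: XS tightened_states_closed_convex)
  have V': "compact V" "convex V"
    using compact_pontryagin_diff[OF polytope_imp_compact[OF U(1)]]
      convex_pontryagin_diff[OF polytope_imp_convex[OF U(1)]] E_nonempty by (simp_all add: V)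
  have Xf: "admissible_invariant Aclb Kb XS V XfS" using XfS by (simp add: max_admissible_invariant_def)
  interpret tube_mpc A Q P B K Kb R N XS XfS E W V
  proof
    show "convex E" by (rule min_robust_invariant_convex[OF Acl(2) W_compact W_convex W_nonempty E])
    show "(A + B ** K) *v e + w \<in> E" if "e \<in> E" "w \<in> W" for e w
      using E_inv that by (auto simp: robust_invariant_def Acl(1) intro: set_plus_intro)
    show "closed XfS" "convex XfS"
      using max_admissible_invariant_closed[OF XfS XS'(1) compact_imp_closed[OF V'(1)]]
        max_admissible_invariant_convex[OF XfS XS'(2) V'(2)] .
    show "XfS \<subseteq> XS" using Xf by (simp add: admissible_invariant_def)
    show "(A + B ** Kb) *v x \<in> XfS" "Kb *v x \<in> V" if "x \<in> XfS" for x
      using Xf that by (auto simp: admissible_invariant_def Aclb(1))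
    show "transpose (A + B ** Kb) ** P ** (A + B ** Kb) - P = - Q - transpose Kb ** R ** Kb"
      using P(2) by (simp add: Aclb(1))
  qed (use N QR P(1) E_compact XS' V' in auto)
  have feas: "feasible (state x0 v t)" if "\<forall>t. v t \<in> W" for v t
    using closed_loop_feasible[OF feasible0] that by blast
  have conv: "(\<lambda>t. INF e\<in>E. d (state x0 v t) e) \<longlonglongrightarrow> 0" if v: "\<forall>t. v t \<in> W" for v
  proof (rule infdist_metric_tendsto_zero[OF d E_compact])
    show "state x0 v t - fst (opt (state x0 v t)) 0 \<in> E" for t
      by (rule initial_error[OF feas[OF v]]) (use v in blast)
    show "(\<lambda>t. state x0 v t - (state x0 v t - fst (opt (state x0 v t)) 0)) \<longlonglongrightarrow> 0"
      using nominal_initial_state_tendsto_zero[OF feasible0] v by simp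
  qed
  have w_meas: "w t \<in> borel_measurable M" for t
    using indep by (auto simp: indep_vars_def)
  \<comment> \<open>Identical distribution carries the mean and the covariance from time 0 to time
    \<open>t\<close>.\<close>
  have moments: "expectation (\<lambda>\<omega>. f (w t \<omega>)) = expectation (\<lambda>\<omega>. f (w 0 \<omega>))"
    if "f \<in> borel_measurable borel" for f :: "real^'n \<Rightarrow> 'c::{banach, second_countable_topology}" and t
    using integral_distr[OF w_meas that, of t] integral_distr[OF w_meas that, of 0] ident[of t] by simp
  have chance: "1 - \<alpha> j \<le> prob {\<omega> \<in> space M. g j \<bullet> state x0 (\<lambda>s. w s \<omega>) (Suc t) \<le> h j}"
    if j: "j \<in> {1..nx}" for t j
  proof -
    define b where "b = min ((\<Sum>i\<in>UNIV. \<bar>g j $ i\<bar>) * aw)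
      (sqrt ((1 - \<alpha> j) / \<alpha> j) * sqrt (g j \<bullet> (\<Sigma>w *v g j)))"
    have "(\<lambda>x::real^'n. x $ i * x $ k) \<in> borel_measurable borel" for i k
      by (intro borel_measurable_continuous_onI continuous_intros)
    then have "\<Sigma>w = (\<chi> i k. expectation (\<lambda>\<omega>. w t \<omega> $ i * w t \<omega> $ k))"
      using moments[of "\<lambda>x. x $ _ * x $ _" t] by (simp add: cov)
    moreover have "expectation (w t) = 0" using moments[of "\<lambda>x. x" t] mean by simp
    ultimately have "1 - \<alpha> j \<le> prob {\<omega> \<in> space M. g j \<bullet> w t \<omega> \<le> b}"
      using bounded_noise_quantile[OF w_meas[of t], of aw "\<alpha> j" "g j"] supp[of t] alpha[OF j] by (simp add: b_def W)
    also have "\<dots> \<le> prob {\<omega> \<in> space M. g j \<bullet> state x0 (\<lambda>s. w s \<omega>) (Suc t) \<le> h j}"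
    proof (rule finite_measure_mono_AE)
      \<comment> \<open>Countably many null sets are merged, so that outside one of them the
        pathwise results apply at all times.\<close>
      have "AE \<omega> in M. \<forall>s. w s \<omega> \<in> W" using supp by (simp add: AE_all_countable)
      then show "AE \<omega> in M. \<omega> \<in> {\<omega> \<in> space M. g j \<bullet> w t \<omega> \<le> b}
        \<longrightarrow> \<omega> \<in> {\<omega> \<in> space M. g j \<bullet> state x0 (\<lambda>s. w s \<omega>) (Suc t) \<le> h j}"
      proof eventually_elim
        fix \<omega> assume v: "\<forall>s. w s \<omega> \<in> W"
        define x where "x = state x0 (\<lambda>s. w s \<omega>) t"
        have x: "feasible x" using feas[OF v] by (simp add: x_def)
        have wt: "w t \<omega> \<in> W" using v by blast
        \<comment> \<open>Boundedness makes the supremum \<open>\<gamma> j\<close> a genuine upper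
          bound for the error contribution.\<close>
        have "compact ((\<lambda>e. g j \<bullet> (Acl *v e)) ` E)"
          by (intro compact_continuous_image E_compact continuous_intros)
        then have "bdd_above ((\<lambda>e. g j \<bullet> (Acl *v e)) ` E)"
          by (intro bounded_imp_bdd_above compact_imp_bounded)
        then have "g j \<bullet> (Acl *v (x - fst (opt x) 0)) \<le> \<gamma> j"
          unfolding gamma[OF j] by (rule cSUP_upper[OF initial_error[OF x wt]])
        moreover have "g j \<bullet> fst (opt x) 1 \<le> h j - \<gamma> j - b"
          using predicted_state[OF x wt] j unfolding XS tightened_states_def b_def by blast
        moreover have "state x0 (\<lambda>s. w s \<omega>) (Suc t) = fst (opt x) 1 + (Acl *v (x - fst (opt x) 0) + w t \<omega>)"
          using successor[OF x wt] by (simp add: x_def Acl(1))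
        ultimately show "\<omega> \<in> {\<omega> \<in> space M. g j \<bullet> w t \<omega> \<le> b}
          \<longrightarrow> \<omega> \<in> {\<omega> \<in> space M. g j \<bullet> state x0 (\<lambda>s. w s \<omega>) (Suc t) \<le> h j}"
          by (simp add: inner_add_right del: closed_loop.simps)
      qed
      \<comment> \<open>Monotonicity of the measure needs the larger event to be measurable; this is
        where the Borel property of the controller enters.\<close>
      have [measurable]: "(\<lambda>\<omega>. state x0 (\<lambda>s. w s \<omega>) (Suc t)) \<in> borel_measurable M"
        by (intro borel_measurable_closed_loop w_meas borel_measurable_input)
      show "{\<omega> \<in> space M. g j \<bullet> state x0 (\<lambda>s. w s \<omega>) (Suc t) \<le> h j} \<in> events"
        by measurable
    qed
    finally show ?thesis .
  qed
  have "1 - \<alpha> j \<le> prob {\<omega> \<in> space M. g j \<bullet> state x0 (\<lambda>s. w s \<omega>) t \<le> h j}"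
    if j: "j \<in> {1..nx}" and t: "t \<ge> 1 \<or> g j \<bullet> x0 \<le> h j" for t j
  proof (cases t)
    case 0
    then show ?thesis using t alpha[OF j] by (simp add: prob_space)
  next
    case (Suc s)
    then show ?thesis using chance[OF j] by simp
  qed
  then show ?thesis
    unfolding kappa using feas conv by blast
qed

end
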